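(* Let $\mathfrak{F}$ be the family of functions whose partition regularity on $\mathbb{N}$ (with given injectivity conditions) is witnessed by at least one ultrafilter $\mathcal{U}\in\overline{\mathbb{M}(\odot)}\cap\overline{\mathbb{I}(\oplus)}\cap\mathcal{BD}$. Then $\mathfrak{F}$ contains: (1) every Rado polynomial $R=c_1x_1+\ldots+c_nx_n+P(y_1,\ldots,y_k)$, with injectivity $|\{x_1,\ldots,x_n\}|\ge n-1$ and $|\{y_1,\ldots,y_k\}|=k$; with injectivity $|\{x_1,x_2\}|=2$ when $n=2$ and $k=1$; and with full injectivity $|\{x_1,\ldots,x_n,y_1,\ldots,y_k\}|=n+k$ when $P\ne0$ is linear; (2) every function $f(x,y_1,\ldots,y_k)=x-\prod_{i=1}^k y_i$, with full injectivity $|\{x,y_1,\ldots,y_k\}|=k+1$; (3) every function $f(x,y_1,\ldots,y_k)=x-\prod_{i=1}^k y_i^{a_i}$ with exponents $a_i\in\mathbb{Z}$ satisfying $\sum_{i=1}^k a_i=1$, with full injectivity $|\{x,y_1,\ldots,y_k\}|=k+1$. Moreover $\mathfrak{F}$ has the following closure properties: (4) if $f(z,y_1,\ldots,y_k)\in\mathfrak{F}$ with injectivity $|\{y_{i_1},\ldots,y_{i_p}\}|\ge s$ and $z-g(x_1,\ldots,x_n)\in\mathfrak{F}$ with injectivity $|\{x_{j_1},\ldots,x_{j_q}\}|\ge t$, then $f(g(x_1,\ldots,x_n),y_1,\ldots,y_k)\in\mathfrak{F}$ with injectivity $|\{x_{j_1},\ldots,x_{j_q}\}|\ge t-1$ and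 $|\{y_{i_1},\ldots,y_{i_p}\}|\ge s-1$; (5) if the homogeneous function $f(x_1,\ldots,x_n)\in\mathfrak{F}$ with injectivity $|\{x_{i_1},\ldots,x_{i_p}\}|\ge s$, then $f(1/x_1,\ldots,1/x_n)\in\mathfrak{F}$ with injectivity $|\{x_{i_1},\ldots,x_{i_p}\}|\ge s$.
   Context: $\mathbb{N}$ is the set of positive integers. An ultrafilter $\mathcal{U}$ on $\mathbb{N}$ witnesses the PR of $f(x_1,\ldots,x_n)$ with injectivity conditions $|\{x_{i_1},\ldots,x_{i_p}\}|\ge s$ (possibly several simultaneously) if for every $A\in\mathcal{U}$ there exist $a_1,\ldots,a_n\in A$ with $f(a_1,\ldots,a_n)=0$ satisfying all the conditions with $a$'s in place of $x$'s. A function $f$ is homogeneous if there is $\ell$ with $f(\lambda x_1,\ldots,\lambda x_n)=\lambda^\ell f(x_1,\ldots,x_n)$ for all $\lambda,x_i$. A Rado polynomial is a polynomial $c_1x_1+\ldots+c_nx_n+P(y_1,\ldots,y_k)$ with $c_i\in\mathbb{Z}$, distinct variables, $n\ge2$, $P\in\mathbb{Z}[y_1,\ldots,y_k]$ without constant term, and some nonempty $J\subseteq\{1,\ldots,n\}$ with $\sum_{j\in J}c_j=0$. $\beta\mathbb{N}$ is the space of ultrafilters on $\mathbb{N}$ with its compact topology and operations $A\in\mathcal{U}\oplus\mathcal{V}\iff\{n\mid \{m\mid m+n\in A\}\in\mathcal{V}\}\in\mathcal{U}$ and $A\in\mathcal{U}\odot\mathcal{V}\iff\{n\mid\{m\mid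 mn\in A\}\in\mathcal{V}\}\in\mathcal{U}$. $K(\odot)$ is the smallest two-sided ideal of $(\beta\mathbb{N},\odot)$; $\mathbb{M}(\odot)$ is the set of $\mathcal{U}\in K(\odot)$ with $\mathcal{U}\odot\mathcal{U}=\mathcal{U}$; $\mathbb{I}(\oplus)$ is the set of $\mathcal{U}$ with $\mathcal{U}\oplus\mathcal{U}=\mathcal{U}$; bars denote topological closure. $\mathcal{BD}$ is the set of ultrafilters all of whose members have positive Banach density (Banach density of $E\subseteq\mathbb{Z}$: the greatest value of $\limsup_n|E\cap[a_n,b_n]|/(b_n-a_n+1)$ over sequences of intervals with $b_n-a_n\to\infty$).
   Formalization: In (4), f and z-g must share a witnessing ultrafilter (false otherwise); one ultrafilter witnesses all of (1)-(3). In (1), c_j is nonzero for j in J, and P is nonzero when n=2, k=1; in (2), k is at least 2; in (3), at least two exponents are nonzero. *)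

theory Defs
  imports "HOL-Analysis.Analysis" "HOL-Library.Poly_Mapping"
begin

section \<open>Ultrafilters on the positive integers\<close>

text \<open>
  An ultrafilter is represented by a library filter \<open>U :: nat filter\<close>; the set \<open>A\<close> is a member
  of \<open>U\<close> iff \<open>\<forall>\<^sub>F n in U. n \<in> A\<close>.  Ultrafilters on the positive integers are those that have
  \<open>{0<..}\<close> as a member.
\<close>

definition ultrafilter :: "'a filter \<Rightarrow> bool" where
  "ultrafilter U \<longleftrightarrow> U \<noteq> bot \<and> (\<forall>P. eventually P U \<or> eventually (\<lambda>x. \<not> P x) U)"

definition betaN :: "nat filter set" where
  "betaN = {U. ultrafilter U \<and> (\<forall>\<^sub>F n in U. 0 < n)}"

definition beta_topology :: "nat filter topology" where
  "beta_topology = topology_generated_by (range (\<lambda>A. {U \<in> betaN. \<forall>\<^sub>F n in U. n \<in> A}))"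

definition uf_op :: "(nat \<Rightarrow> nat \<Rightarrow> nat) \<Rightarrow> nat filter \<Rightarrow> nat filter \<Rightarrow> nat filter" where
  "uf_op h U V = Abs_filter (\<lambda>P. \<forall>\<^sub>F n in U. \<forall>\<^sub>F m in V. P (h m n))"

lemma eventually_uf_op:
  "eventually P (uf_op h U V) \<longleftrightarrow> (\<forall>\<^sub>F n in U. \<forall>\<^sub>F m in V. P (h m n))"
  unfolding uf_op_def
proof (rule eventually_Abs_filter, rule is_filter.intro)
  show "\<forall>\<^sub>F n in U. \<forall>\<^sub>F m in V. True" by simp
next
  fix P Q :: "nat \<Rightarrow> bool"
  assume "\<forall>\<^sub>F n in U. \<forall>\<^sub>F m in V. P (h m n)" "\<forall>\<^sub>F n in U. \<forall>\<^sub>F m in V. Q (h m n)"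
  then show "\<forall>\<^sub>F n in U. \<forall>\<^sub>F m in V. P (h m n) \<and> Q (h m n)"
    by eventually_elim (rule eventually_conj)
next
  fix P Q :: "nat \<Rightarrow> bool"
  assume PQ: "\<forall>x. P x \<longrightarrow> Q x" and "\<forall>\<^sub>F n in U. \<forall>\<^sub>F m in V. P (h m n)"
  from this(2) show "\<forall>\<^sub>F n in U. \<forall>\<^sub>F m in V. Q (h m n)"
    by eventually_elim (auto elim: eventually_mono simp: PQ)
qed

definition uf_plus :: "nat filter \<Rightarrow> nat filter \<Rightarrow> nat filter" (infixl \<open>\<oplus>\<^sub>\<beta>\<close> 65) where
  "U \<oplus>\<^sub>\<beta> V = uf_op (+) U V"

definition uf_times :: "nat filter \<Rightarrow> nat filter \<Rightarrow> nat filter" (infixl \<open>\<odot>\<^sub>\<beta>\<close> 70) where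
  "U \<odot>\<^sub>\<beta> V = uf_op (*) U V"

definition two_sided_ideal :: "nat filter set \<Rightarrow> bool" where
  "two_sided_ideal I \<longleftrightarrow>
     I \<noteq> {} \<and> I \<subseteq> betaN \<and> (\<forall>U\<in>I. \<forall>V\<in>betaN. U \<odot>\<^sub>\<beta> V \<in> I \<and> V \<odot>\<^sub>\<beta> U \<in> I)"

text \<open>
  The smallest two-sided ideal is the intersection of all of them (which is again an ideal, by the
  theory of compact right topological semigroups).
\<close>

definition K_times :: "nat filter set" where
  "K_times = \<Inter>{I. two_sided_ideal I}"

definition M_times :: "nat filter set" where
  "M_times = {U \<in> K_times. U \<odot>\<^sub>\<beta> U = U}"

definition I_plus :: "nat filter set" where
  "I_plus = {U \<in> betaN. U \<oplus>\<^sub>\<beta> U = U}"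

text \<open>
  The supremum below is attained, so it is the greatest value of the upper limit.
\<close>

definition banach_density :: "int set \<Rightarrow> ereal" where
  "banach_density E =
     Sup {limsup (\<lambda>n. ereal (real (card (E \<inter> {a n..b n})) / real_of_int (b n - a n + 1))) | a b.
            filterlim (\<lambda>n. b n - a n) at_top sequentially}"

definition BD :: "nat filter set" where
  "BD = {U \<in> betaN. \<forall>A \<subseteq> {0<..}. (\<forall>\<^sub>F n in U. n \<in> A) \<longrightarrow> 0 < banach_density (int ` A)}"

definition good_ultrafilters :: "nat filter set" where
  "good_ultrafilters =
     (beta_topology closure_of M_times) \<inter> (beta_topology closure_of I_plus) \<inter> BD"

section \<open>Partition regularity with injectivity conditions\<close>

text \<open>
  A function of \<open>n\<close> variables is given by its values on lists of length \<open>n\<close>, the variables being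
  numbered from \<open>0\<close>.  A pair \<open>(I, s)\<close> in \<open>C\<close> is the injectivity condition that the variables with
  index in \<open>I\<close> take at least \<open>s\<close> different values.
\<close>

definition witnesses ::
  "nat filter \<Rightarrow> nat \<Rightarrow> (real list \<Rightarrow> real) \<Rightarrow> (nat set \<times> nat) set \<Rightarrow> bool" where
  "witnesses U n f C \<longleftrightarrow>
     (\<forall>A \<subseteq> {0<..}. (\<forall>\<^sub>F m in U. m \<in> A) \<longrightarrow>
        (\<exists>xs :: nat list. length xs = n \<and> set xs \<subseteq> A \<and> f (map real xs) = 0 \<and>
           (\<forall>(I, s)\<in>C. s \<le> card ((\<lambda>i. xs ! i) ` I))))"

text \<open>
  For positive \<open>r\<close>, \<open>powr\<close> agrees with the integer powers.  The arguments only range over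
  positive reals, which is where partition regularity of \<open>f\<close> and of its composition with
  reciprocals takes place.
\<close>

definition homogeneous :: "nat \<Rightarrow> (real list \<Rightarrow> real) \<Rightarrow> bool" where
  "homogeneous n f \<longleftrightarrow>
     (\<exists>l :: real. \<forall>r>0. \<forall>xs. length xs = n \<and> (\<forall>x\<in>set xs. 0 < x) \<longrightarrow>
        f (map (\<lambda>x. r * x) xs) = r powr l * f xs)"

section \<open>Rado polynomials\<close>

text \<open>
  Integer polynomials in variables numbered by natural numbers: a monomial maps variables to
  exponents and a polynomial maps monomials to coefficients, both with finite support.
\<close>

type_synonym int_mpoly = "((nat \<Rightarrow>\<^sub>0 nat) \<Rightarrow>\<^sub>0 int)"

definition mpoly_eval :: "(nat \<Rightarrow> real) \<Rightarrow> int_mpoly \<Rightarrow> real" where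
  "mpoly_eval y P =
     (\<Sum>m\<in>Poly_Mapping.keys P. of_int (Poly_Mapping.lookup P m) *
        (\<Prod>i\<in>Poly_Mapping.keys m. y i ^ Poly_Mapping.lookup m i))"

definition mpoly_vars :: "int_mpoly \<Rightarrow> nat set" where
  "mpoly_vars P = (\<Union>m\<in>Poly_Mapping.keys P. Poly_Mapping.keys m)"

definition mpoly_linear :: "int_mpoly \<Rightarrow> bool" where
  "mpoly_linear P \<longleftrightarrow>
     (\<forall>m\<in>Poly_Mapping.keys P. (\<Sum>i\<in>Poly_Mapping.keys m. Poly_Mapping.lookup m i) \<le> 1)"

text \<open>
  The coefficients \<open>c j\<close> with \<open>j \<in> J\<close> are required to be nonzero: with \<open>c j = 0\<close> allowed, the
  condition would hold for every linear form that has a vanishing coefficient.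
\<close>

definition rado_polynomial :: "nat \<Rightarrow> (nat \<Rightarrow> int) \<Rightarrow> nat \<Rightarrow> int_mpoly \<Rightarrow> bool" where
  "rado_polynomial n c k P \<longleftrightarrow>
     2 \<le> n \<and> mpoly_vars P \<subseteq> {..<k} \<and> Poly_Mapping.lookup P 0 = 0 \<and>
     (\<exists>J \<subseteq> {..<n}. J \<noteq> {} \<and> (\<forall>j\<in>J. c j \<noteq> 0) \<and> (\<Sum>j\<in>J. c j) = 0)"

text \<open>The variables \<open>x\<close> come first in the argument list, followed by the variables \<open>y\<close>.\<close>

definition rado_fun :: "nat \<Rightarrow> (nat \<Rightarrow> int) \<Rightarrow> int_mpoly \<Rightarrow> real list \<Rightarrow> real" where
  "rado_fun n c P v = (\<Sum>i<n. of_int (c i) * v ! i) + mpoly_eval (\<lambda>i. v ! (n + i)) P"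

end

theory Submission
  imports Defs
begin

text \<open>
  A closed set of ultrafilters is the set of ultrafilters below a filter, so minimal closed invariant
  sets and idempotents are found by Zorn's lemma on filters. Let \<open>p\<close> be an additive idempotent below
  a minimal translation-invariant filter \<open>\<Phi>\<close> on the integers. Colour focusing with PET induction shows
  that for every set \<open>A\<close> positive for \<open>\<Phi>\<close> and finitely many integer polynomials \<open>f\<close> with \<open>f 0 = 0\<close>,
  the set \<open>A \<inter> \<Inter>\<^sub>f (A - f n)\<close> is positive for \<open>p\<close>-most \<open>n\<close>. Hence every member of \<open>p\<close> solves all Rado
  equations and has positive Banach density, since positive sets are piecewise syndetic. Both
  properties survive dilation, so the closure of the set of such idempotents is a left ideal of
  \<open>(\<beta>\<nat>, \<odot>)\<close>, which contains a multiplicative idempotent \<open>U\<close> of \<open>K(\<odot>)\<close>. Products are found in members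
  of \<open>U\<close> because \<open>U \<odot> U = U\<close>. The ultrafilters witnessing a multiplicatively homogeneous pattern,
  such as geometric progressions, form an ideal, which therefore contains \<open>K(\<odot>)\<close>.
\<close>

section \<open>Closed sets of ultrafilters as filters\<close>

text \<open>A limit of additive idempotents need not be idempotent, so the additive side enters
  \<open>U\<close> only through its members: what is wanted from additive idempotents is formulated
  for single sets (\<open>block_dense\<close>, \<open>rado_solvable\<close>), and every member of
  \<open>U\<close> is a member of some such idempotent. A dilate of an ultrafilter is its product
  with an integer, and products of ultrafilters are limits of dilates; this is why invariance under
  dilations alone yields a left ideal. Recurrence is set up on the integers because polynomials take
  negative values, and keeping \<open>\<Phi>\<close> below \<open>at_top\<close> makes the base
  points positive and as large as desired. Return times alone leave the variables free to coincide,
  so non-vanishing conditions are carried along with them. Rado equations use the members of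
  \<open>U\<close>, products its idempotence, and monomials its place in \<open>K_times\<close>; the
  closure under reciprocals has to work for any ultrafilter in the closure of
  \<open>M_times\<close>.\<close>

lemma ex_minimal_filter:
  fixes F :: "'a filter"
  assumes "F \<noteq> bot" "Q F"
    and Inf_closed: "\<And>C. C \<noteq> {} \<Longrightarrow> (\<And>G. G \<in> C \<Longrightarrow> Q G) \<Longrightarrow> Q (Inf C)"
  obtains G where "G \<le> F" "G \<noteq> bot" "Q G"
    "\<And>G'. G' \<le> G \<Longrightarrow> G' \<noteq> bot \<Longrightarrow> Q G' \<Longrightarrow> G' = G"
proof -
  define S where "S = {G. G \<le> F \<and> G \<noteq> bot \<and> Q G}"
  have "\<exists>m\<in>S. \<forall>a\<in>S. m \<ge> a \<longrightarrow> a = m"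
  proof (rule predicate_Zorn)
    show "partial_order_on S (relation_of (\<ge>) S)"
      by (rule partial_order_on_relation_ofI) auto
  next
    fix C assume C: "C \<in> Chains (relation_of (\<ge>) S)"
    have CS: "C \<subseteq> S" and chain: "\<And>G H. G \<in> C \<Longrightarrow> H \<in> C \<Longrightarrow> G \<le> H \<or> H \<le> G"
      using C unfolding Chains_def relation_of_def by auto
    show "\<exists>u\<in>S. \<forall>a\<in>C. a \<ge> u"
    proof (cases "C = {}")
      case True
      then show ?thesis using assms by (auto simp: S_def)
    next
      case False
      \<comment> \<open>This is the compactness step: the members of a chain are directed downward,
        so what holds eventually in the infimum already holds eventually in one member, and the
        infimum is not trivial.\<close>
      have "eventually (\<lambda>_. False) (Inf C) \<longleftrightarrow> (\<exists>b\<in>C. eventually (\<lambda>_. False) b)"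
        by (rule eventually_Inf_base[OF False]) (metis chain inf.absorb1 inf.absorb2 order_refl)
      then have "Inf C \<noteq> bot"
        using CS by (auto simp: S_def trivial_limit_def)
      moreover have "Inf C \<le> F"
        using False CS by (auto simp: S_def intro: Inf_lower2)
      moreover have "Q (Inf C)"
        using CS by (intro Inf_closed[OF False]) (auto simp: S_def)
      ultimately show ?thesis
        by (intro bexI[of _ "Inf C"]) (auto simp: S_def Inf_lower)
    qed
  qed
  then show ?thesis
    unfolding S_def using that by (smt (verit) mem_Collect_eq order_trans)
qed

section \<open>Ultrafilters and products of filters\<close>

lemma ultrafilterD_not:
  "ultrafilter U \<Longrightarrow> \<not> eventually P U \<Longrightarrow> eventually (\<lambda>x. \<not> P x) U"
  unfolding ultrafilter_def by blast

lemma ultrafilter_neq_bot: "ultrafilter U \<Longrightarrow> U \<noteq> bot"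
  unfolding ultrafilter_def by blast

lemma ultrafilter_not_iff:
  assumes "ultrafilter U"
  shows "eventually (\<lambda>x. \<not> P x) U \<longleftrightarrow> \<not> eventually P U"
proof
  assume "eventually (\<lambda>x. \<not> P x) U"
  show "\<not> eventually P U"
  proof
    assume "eventually P U"
    with \<open>eventually (\<lambda>x. \<not> P x) U\<close> have "eventually (\<lambda>_. False) U"
      by eventually_elim blast
    then show False
      using ultrafilter_neq_bot[OF assms] by (simp add: trivial_limit_def)
  qed
qed (rule ultrafilterD_not[OF assms])

lemma ultrafilter_le_eq:
  assumes "ultrafilter U" "F \<le> U" "F \<noteq> bot"
  shows "F = U"
proof (rule antisym[OF assms(2)], rule filter_leI)
  fix P assume P: "eventually P F"
  show "eventually P U"
  proof (rule ccontr)
    assume "\<not> eventually P U"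
    then have "eventually (\<lambda>x. \<not> P x) F"
      using ultrafilterD_not[OF assms(1)] filter_leD[OF assms(2)] by blast
    with P have "eventually (\<lambda>_. False) F" by eventually_elim blast
    with assms(3) show False by (simp add: trivial_limit_def)
  qed
qed

lemma ultrafilter_filtermap: "ultrafilter U \<Longrightarrow> ultrafilter (filtermap f U)"
  unfolding ultrafilter_def by (auto simp: eventually_filtermap filtermap_bot_iff)

lemma ultrafilter_uf_op: "ultrafilter U \<Longrightarrow> ultrafilter V \<Longrightarrow> ultrafilter (uf_op h U V)"
  by (auto simp: ultrafilter_def[of "uf_op h U V"] eventually_uf_op ultrafilter_not_iff
      trivial_limit_def ultrafilter_neq_bot[unfolded trivial_limit_def])

text \<open>A minimal nontrivial filter is an ultrafilter: intersecting it with the principal filter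
  of a set either makes it trivial or changes nothing.\<close>

lemma ex_ultrafilter_le:
  assumes "F \<noteq> bot"
  obtains U where "ultrafilter U" "U \<le> F"
proof -
  obtain U where U: "U \<le> F" "U \<noteq> bot"
    and min: "\<And>G. G \<le> U \<Longrightarrow> G \<noteq> bot \<Longrightarrow> True \<Longrightarrow> G = U"
    using ex_minimal_filter[of F "\<lambda>_. True"] assms by blast
  have "eventually P U \<or> eventually (\<lambda>x. \<not> P x) U" for P
  proof (cases "inf U (principal {x. P x}) = bot")
    case True
    then have "eventually (\<lambda>_. False) (inf U (principal {x. P x}))" by simp
    then show ?thesis by (simp add: eventually_inf_principal)
  next
    case False
    then have "inf U (principal {x. P x}) = U" using min by simp
    moreover have "eventually P (inf U (principal {x. P x}))"
      by (simp add: eventually_inf_principal)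
    ultimately show ?thesis by simp
  qed
  then show thesis using that U by (auto simp: ultrafilter_def)
qed

lemma eventually_ultrafilter_finite_Ex:
  assumes "ultrafilter U" "finite X" "eventually (\<lambda>n. \<exists>x\<in>X. P x n) U"
  shows "\<exists>x\<in>X. eventually (P x) U"
proof (rule ccontr)
  assume "\<not> ?thesis"
  then have "\<forall>x\<in>X. eventually (\<lambda>n. \<not> P x n) U"
    using assms(1) by (auto simp: ultrafilter_not_iff)
  then have "eventually (\<lambda>n. \<forall>x\<in>X. \<not> P x n) U"
    using assms(2) by (simp add: eventually_ball_finite)
  with assms(3) have "eventually (\<lambda>_. False) U" by eventually_elim blast
  then show False
    using ultrafilter_neq_bot[OF assms(1)] by (simp add: trivial_limit_def)
qed

lemma uf_op_mono: "F \<le> F' \<Longrightarrow> G \<le> G' \<Longrightarrow> uf_op h F G \<le> uf_op h F' G'"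
  unfolding le_filter_def eventually_uf_op by (blast intro: eventually_mono)

lemma uf_op_eq_bot_iff: "uf_op h F G = bot \<longleftrightarrow> F = bot \<or> G = bot"
  unfolding trivial_limit_def eventually_uf_op
  by (cases "eventually (\<lambda>_. False) G") (auto elim: eventually_mono)

lemma uf_op_assoc:
  assumes "\<And>a b c. h (h a b) c = h a (h b c)"
  shows "uf_op h (uf_op h U V) W = uf_op h U (uf_op h V W)"
  by (simp add: filter_eq_iff eventually_uf_op assms)

text \<open>The map \<open>U \<mapsto> uf_op h U V\<close> is continuous, so it maps the closed set of ultrafilters below
  \<open>F\<close> onto the closed set of ultrafilters below \<open>uf_op h F V\<close>.\<close>

lemma ultrafilter_le_uf_op_lift:
  assumes W: "ultrafilter W" "W \<le> uf_op h F V" and V: "ultrafilter V"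
  obtains U where "ultrafilter U" "U \<le> F" "uf_op h U V = W"
proof -
  \<comment> \<open>\<open>G\<close> is the preimage of \<open>W\<close> under the map that sends
    \<open>n\<close> to the limit of \<open>h m n\<close> along \<open>V\<close>. It is compatible
    with \<open>F\<close> because \<open>W\<close> lies below \<open>uf_op h F V\<close>.\<close>
  define G where "G = (INF P\<in>{P. eventually P W}. principal {n. eventually (\<lambda>m. P (h m n)) V})"
  have G: "eventually Q G \<longleftrightarrow>
      (\<exists>P. eventually P W \<and> (\<forall>n. eventually (\<lambda>m. P (h m n)) V \<longrightarrow> Q n))" for Q
    unfolding G_def
  proof (subst eventually_INF_base)
    fix P P' assume "P \<in> {P. eventually P W}" "P' \<in> {P. eventually P W}"
    then show "\<exists>x\<in>{P. eventually P W}. principal {n. eventually (\<lambda>m. x (h m n)) V}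
        \<le> inf (principal {n. eventually (\<lambda>m. P (h m n)) V})
              (principal {n. eventually (\<lambda>m. P' (h m n)) V})"
      by (intro bexI[of _ "\<lambda>x. P x \<and> P' x"])
         (auto simp: eventually_conj_iff)
  qed (auto simp: eventually_principal intro: exI[of _ "\<lambda>_. True"])
  have "inf F G \<noteq> bot"
  proof
    assume "inf F G = bot"
    then have "eventually (\<lambda>_. False) (inf F G)" by simp
    then obtain A B where A: "eventually A F" and B: "eventually B G"
      and AB: "\<And>n. \<not> (A n \<and> B n)"
      unfolding eventually_inf by blast
    obtain P where P: "eventually P W" "\<And>n. eventually (\<lambda>m. P (h m n)) V \<Longrightarrow> B n"
      using B G by blast
    have "eventually (\<lambda>n. \<not> eventually (\<lambda>m. P (h m n)) V) F"
      using A by eventually_elim (use AB P in blast)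
    then have "eventually (\<lambda>x. \<not> P x) (uf_op h F V)"
      unfolding eventually_uf_op ultrafilter_not_iff[OF V] .
    then show False
      using W P(1) filter_leD ultrafilter_not_iff by blast
  qed
  then obtain U where U: "ultrafilter U" "U \<le> inf F G"
    by (rule ex_ultrafilter_le)
  have "uf_op h U V \<le> W"
  proof (rule filter_leI)
    fix P assume "eventually P W"
    then have "eventually (\<lambda>n. eventually (\<lambda>m. P (h m n)) V) G"
      using G by blast
    then show "eventually P (uf_op h U V)"
      unfolding eventually_uf_op using U(2) by (meson filter_leD le_inf_iff)
  qed
  then have "uf_op h U V = W"
    using U V W by (intro ultrafilter_le_eq) (auto simp: uf_op_eq_bot_iff ultrafilter_neq_bot)
  then show thesis using that U by simp
qed

text \<open>The Ellis--Numakura lemma, for the compact right topological semigroup of the ultrafilters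
  below \<open>F\<close>.\<close>

lemma ex_idempotent_le:
  assumes assoc: "\<And>a b c. h (h a b) c = h a (h b c)"
    and "F \<noteq> bot" and semi: "\<And>V. ultrafilter V \<Longrightarrow> V \<le> F \<Longrightarrow> uf_op h F V \<le> F"
  obtains U where "ultrafilter U" "U \<le> F" "uf_op h U U = U"
proof -
  define Q where "Q F \<longleftrightarrow> (\<forall>V. ultrafilter V \<longrightarrow> V \<le> F \<longrightarrow> uf_op h F V \<le> F)" for F
  have "Q F" using semi by (simp add: Q_def)
  have "Q (Inf C)" if "\<And>G. G \<in> C \<Longrightarrow> Q G" for C
    unfolding Q_def
  proof (intro allI impI Inf_greatest)
    fix V G assume V: "ultrafilter V" "V \<le> Inf C" and "G \<in> C"
    then have "Inf C \<le> G" by (simp add: Inf_lower)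
    have "uf_op h (Inf C) V \<le> uf_op h G V"
      using \<open>Inf C \<le> G\<close> by (simp add: uf_op_mono)
    also have "\<dots> \<le> G"
      using that[OF \<open>G \<in> C\<close>] V \<open>Inf C \<le> G\<close> unfolding Q_def by auto
    finally show "uf_op h (Inf C) V \<le> G" .
  qed
  then obtain G where G: "G \<le> F" "G \<noteq> bot" "Q G"
    and min: "\<And>G'. G' \<le> G \<Longrightarrow> G' \<noteq> bot \<Longrightarrow> Q G' \<Longrightarrow> G' = G"
    using ex_minimal_filter[of F Q] \<open>F \<noteq> bot\<close> \<open>Q F\<close> by blast
  obtain V where V: "ultrafilter V" "V \<le> G"
    using ex_ultrafilter_le[OF G(2)] .
  have GV: "uf_op h G V \<le> G" using G(3) V by (simp add: Q_def)
  \<comment> \<open>Multiplying the semigroup by one of its elements \<open>V\<close> gives a closed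
    subsemigroup again, so minimality makes it everything, and \<open>V\<close> itself becomes a
    multiple of \<open>V\<close>.\<close>
  have "Q (uf_op h G V)"
    unfolding Q_def
  proof (intro allI impI)
    fix W assume W: "ultrafilter W" "W \<le> uf_op h G V"
    obtain U where U: "ultrafilter U" "U \<le> G" "uf_op h U V = W"
      using ultrafilter_le_uf_op_lift[OF W V(1)] .
    have "uf_op h (uf_op h G V) W = uf_op h (uf_op h (uf_op h G V) U) V"
      by (simp add: uf_op_assoc[OF assoc] flip: U(3))
    also have "\<dots> \<le> uf_op h (uf_op h G U) V"
      by (intro uf_op_mono GV order_refl)
    also have "\<dots> \<le> uf_op h G V"
      using G(3) U by (intro uf_op_mono) (auto simp: Q_def)
    finally show "uf_op h (uf_op h G V) W \<le> uf_op h G V" .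
  qed
  then have "uf_op h G V = G"
    using GV min G(2) V by (simp add: uf_op_eq_bot_iff ultrafilter_neq_bot)
  then obtain U where U: "ultrafilter U" "U \<le> G" "uf_op h U V = V"
    using ultrafilter_le_uf_op_lift[OF V(1), of h G V] V by auto
  \<comment> \<open>The filters below \<open>E\<close> are the \<open>X\<close> whose product with
    \<open>V\<close> is below \<open>V\<close>. Inside \<open>G\<close> these form a closed
    subsemigroup, which contains \<open>U\<close>; minimality makes it all of \<open>G\<close>, so
    it contains \<open>V\<close>.\<close>
  define E where "E = (INF P\<in>{P. eventually P V}. principal {n. eventually (\<lambda>m. P (h m n)) V})"
  have E: "X \<le> E \<longleftrightarrow> uf_op h X V \<le> V" for X
    by (auto simp: E_def le_INF_iff le_principal le_filter_def[of "uf_op h X V"] eventually_uf_op)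
  have "inf G E \<noteq> bot"
    using U E[of U] ultrafilter_neq_bot by (metis bot.extremum_uniqueI le_inf_iff order_refl)
  moreover have "Q (inf G E)"
    unfolding Q_def
  proof (intro allI impI)
    fix W assume W: "ultrafilter W" "W \<le> inf G E"
    have "uf_op h (inf G E) W \<le> uf_op h G W" by (simp add: uf_op_mono)
    also have "\<dots> \<le> G" using G(3) W by (simp add: Q_def)
    finally have 1: "uf_op h (inf G E) W \<le> G" .
    have "uf_op h (uf_op h (inf G E) W) V = uf_op h (inf G E) (uf_op h W V)"
      by (simp add: uf_op_assoc[OF assoc])
    also have "\<dots> \<le> uf_op h (inf G E) V"
      using W E by (intro uf_op_mono) auto
    also have "\<dots> \<le> V" using E[of "inf G E"] by simp
    finally show "uf_op h (inf G E) W \<le> inf G E"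
      using 1 E by simp
  qed
  ultimately have "inf G E = G" using min[of "inf G E"] by simp
  then have "uf_op h V V \<le> V" using V E by (metis le_inf_iff)
  then have "uf_op h V V = V"
    using V by (intro ultrafilter_le_eq) (auto simp: uf_op_eq_bot_iff ultrafilter_neq_bot)
  then show thesis using that V G by (meson order_trans)
qed

text \<open>In terms of closed sets: the continuous extension of each \<open>t\<close> maps the set
  of ultrafilters below \<open>F\<close> into itself. The inequality is preserved by infima, as
  Zorn's lemma requires.\<close>

definition invariant_filter :: "('a \<Rightarrow> 'a) set \<Rightarrow> 'a filter \<Rightarrow> bool" where
  "invariant_filter T F \<longleftrightarrow> (\<forall>t\<in>T. filtermap t F \<le> F)"

lemma invariant_filterD:
  "invariant_filter T F \<Longrightarrow> t \<in> T \<Longrightarrow> eventually P F \<Longrightarrow> eventually (\<lambda>x. P (t x)) F"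
  unfolding invariant_filter_def by (metis eventually_filtermap filter_leD)

lemma ex_minimal_invariant_filter:
  assumes "F \<noteq> bot" "invariant_filter T F"
  obtains G where "G \<le> F" "G \<noteq> bot" "invariant_filter T G"
    "\<And>G'. G' \<le> G \<Longrightarrow> G' \<noteq> bot \<Longrightarrow> invariant_filter T G' \<Longrightarrow> G' = G"
proof (rule ex_minimal_filter[of F "invariant_filter T"])
  fix C :: "'a filter set" assume C: "\<And>G. G \<in> C \<Longrightarrow> invariant_filter T G"
  show "invariant_filter T (Inf C)"
    unfolding invariant_filter_def
  proof (intro ballI Inf_greatest)
    fix t G assume "t \<in> T" "G \<in> C"
    then have "filtermap t (Inf C) \<le> filtermap t G" by (intro filtermap_mono Inf_lower)
    also have "\<dots> \<le> G"
      using C[OF \<open>G \<in> C\<close>] \<open>t \<in> T\<close> by (simp add: invariant_filter_def)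
    finally show "filtermap t (Inf C) \<le> G" .
  qed
qed (use assms that in auto)

text \<open>A minimal translation-invariant filter is a minimal subsystem of \<open>\<beta>\<int>\<close>.\<close>

lemma minimal_invariant_filter_cover:
  fixes \<Phi> :: "int filter"
  assumes inv: "invariant_filter (range (+)) \<Phi>"
    and min: "\<And>G. G \<le> \<Phi> \<Longrightarrow> G \<noteq> bot \<Longrightarrow> invariant_filter (range (+)) G \<Longrightarrow> G = \<Phi>"
    and P: "frequently P \<Phi>"
  obtains H where "finite H" "eventually (\<lambda>a. \<exists>h\<in>H. P (a + h)) \<Phi>"
proof -
  \<comment> \<open>This is the closed set of points whose whole orbit avoids \<open>P\<close>. It
    is invariant, and proper because \<open>P\<close> is frequent, so minimality makes it empty; by
    compactness finitely many translates already suffice.\<close>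
  define G where "G = inf \<Phi> (INF t. principal {a. \<not> P (a + t)})"
  have "invariant_filter (range (+)) G"
    unfolding invariant_filter_def
  proof (clarify)
    fix s
    have "filtermap ((+) s) G \<le> filtermap ((+) s) \<Phi>"
      unfolding G_def by (intro filtermap_mono) simp
    also have "\<dots> \<le> \<Phi>" using inv by (simp add: invariant_filter_def)
    finally have "filtermap ((+) s) G \<le> \<Phi>" .
    moreover have "filtermap ((+) s) G \<le> principal {a. \<not> P (a + t)}" for t
    proof -
      have "G \<le> principal {a. \<not> P (a + (s + t))}"
        unfolding G_def by (intro le_infI2 INF_lower) simp
      then show ?thesis
        by (simp add: le_principal eventually_filtermap add_ac)
    qed
    ultimately show "filtermap ((+) s) G \<le> G"
      by (subst (2) G_def) (intro le_infI INF_greatest)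
  qed
  have "G = bot"
  proof (rule ccontr)
    assume "G \<noteq> bot"
    then have "G = \<Phi>"
      using \<open>invariant_filter (range (+)) G\<close> by (intro min) (auto simp: G_def)
    moreover have "G \<le> principal {a. \<not> P (a + 0)}"
      unfolding G_def by (intro le_infI2 INF_lower) simp
    ultimately show False using P by (simp add: le_principal frequently_def)
  qed
  then have "eventually (\<lambda>_. False) G" by simp
  then obtain A B where A: "eventually A \<Phi>"
    and B: "eventually B (INF t. principal {a. \<not> P (a + t)})" and AB: "\<And>n. \<not> (A n \<and> B n)"
    unfolding G_def eventually_inf by blast
  obtain H where H: "finite H" "eventually B (INF t\<in>H. principal {a. \<not> P (a + t)})"
    using iffD1[OF eventually_INF B] by blast
  then have "\<And>a. (\<forall>h\<in>H. \<not> P (a + h)) \<Longrightarrow> B a"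
    by (simp add: INF_principal_finite eventually_principal)
  then have "eventually (\<lambda>a. \<exists>h\<in>H. P (a + h)) \<Phi>"
    by (intro eventually_mono[OF A]) (use AB in blast)
  with H(1) show thesis by (rule that)
qed

section \<open>Polynomial recurrence along idempotents\<close>

definition degree_leads :: "int poly set \<Rightarrow> (nat \<times> int) set" where
  "degree_leads F = (\<lambda>f. (degree f, lead_coeff f)) ` F"

text \<open>A degree is counted once for each leading coefficient that occurs in that degree, so
  shifts of one polynomial do not add to the weight. The multiset order compares the counts from the
  highest degree downward and is well-founded.\<close>

definition pet_weight :: "int poly set \<Rightarrow> nat multiset" where
  "pet_weight F = image_mset fst (mset_set (degree_leads F))"

text \<open>Translating the argument changes only coefficients below the top one, and positive
  degree keeps the constant term away from the leading coefficient.\<close>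

lemma shifted_poly_degree_lead:
  fixes f :: "int poly"
  assumes "degree f > 0"
  shows "degree (pcompose f [:s, 1:] - [:c:]) = degree f"
    "lead_coeff (pcompose f [:s, 1:] - [:c:]) = lead_coeff f"
proof -
  have 1: "degree (pcompose f [:s, 1:]) = degree f"
    by (simp add: degree_pcompose)
  have 3: "lead_coeff (pcompose f [:s, 1:]) = lead_coeff f"
    by (subst lead_coeff_comp) auto
  have 2: "degree (- [:c:]) < degree (pcompose f [:s, 1:])" using assms 1 by simp
  show "degree (pcompose f [:s, 1:] - [:c:]) = degree f"
    unfolding diff_conv_add_uminus degree_add_eq_left[OF 2] by (rule 1)
  then show "lead_coeff (pcompose f [:s, 1:] - [:c:]) = lead_coeff f"
    using assms 1 3 by (simp add: coeff_pCons split: nat.splits)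
qed

text \<open>Subtracting \<open>f\<^sub>1\<close> of least degree \<open>d\<close> keeps the pairs of degree above \<open>d\<close>, moves the leading
  coefficients in degree \<open>d\<close> by that of \<open>f\<^sub>1\<close>, which therefore disappears, and apart from this only
  creates polynomials of degree below \<open>d\<close>.\<close>

lemma pet_weight_decreases:
  fixes F :: "int poly set" and S :: "int set"
  assumes fin: "finite F" "finite S" and S0: "0 \<in> S"
    and deg: "\<And>f. f \<in> F \<Longrightarrow> degree f > 0"
    and f1: "f1 \<in> F" "\<And>f. f \<in> F \<Longrightarrow> degree f1 \<le> degree f"
    and null: "\<And>f. f \<in> F \<Longrightarrow> poly f 0 = 0"
  defines "G \<equiv> (\<lambda>(f, s). pcompose f [:s, 1:] - [:poly f s:] - f1) ` (F \<times> S) - {0}"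
  shows "(pet_weight G, pet_weight F) \<in> mult less_than"
proof -
  define d where "d = degree f1"
  define l where "l = lead_coeff f1"
  define \<phi> where "\<phi> = (\<lambda>(e, c). if e = d then (e, c - l) else (e, c))"
  define X where "X = degree_leads F - {(d, l)}"
  define low where "low = {q \<in> degree_leads G. fst q < d}"
  have g: "if degree f = d \<and> lead_coeff f = l
           then g = 0 \<or> degree g < d
           else g \<noteq> 0 \<and> (degree g, lead_coeff g) = \<phi> (degree f, lead_coeff f)"
    if f: "f \<in> F" and g: "g = pcompose f [:s, 1:] - [:poly f s:] - f1" for f s g
  proof -
    define f' where "f' = pcompose f [:s, 1:] - [:poly f s:]"
    have f': "degree f' = degree f" "lead_coeff f' = lead_coeff f"
      unfolding f'_def by (rule shifted_poly_degree_lead[OF deg[OF f]])+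
    have gf: "g = f' - f1" by (simp add: g f'_def)
    have df: "d \<le> degree f" using f1(2)[OF f] by (simp add: d_def)
    show ?thesis
    proof (cases "degree f = d")
      case False
      then have lt: "degree (- f1) < degree f'" using df f' by (simp add: d_def)
      have 1: "degree g = degree f"
        using degree_add_eq_left[OF lt] f' by (simp add: gf)
      moreover have "lead_coeff g = lead_coeff f"
        using 1 lt f' by (simp add: gf coeff_eq_0)
      moreover have "g \<noteq> 0" using 1 deg[OF f] by auto
      ultimately show ?thesis using False by (simp add: \<phi>_def)
    next
      case True
      have le: "degree g \<le> d"
        unfolding gf using f' True by (intro degree_diff_le) (auto simp: d_def)
      have cf: "coeff g d = lead_coeff f - l"
        using f' True by (simp add: gf l_def d_def)
      show ?thesis
      proof (cases "lead_coeff f = l")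
        case True
        then have "coeff g d = 0" using cf by simp
        then have "g = 0 \<or> degree g \<noteq> d" by (metis leading_coeff_0_iff)
        then show ?thesis using le \<open>degree f = d\<close> True by auto
      next
        case False
        then have "coeff g d \<noteq> 0" using cf by simp
        then have "degree g = d" "g \<noteq> 0" using le le_degree by (auto intro: antisym)
        then show ?thesis using False cf \<open>degree f = d\<close> by (simp add: \<phi>_def)
      qed
    qed
  qed
  have finD: "finite (degree_leads F)" "finite (degree_leads G)"
    using fin by (auto simp: degree_leads_def G_def)
  have "degree_leads G = \<phi> ` X \<union> low"
  proof (intro equalityI subsetI)
    fix q assume "q \<in> degree_leads G"
    then obtain h where h: "h \<in> G" "q = (degree h, lead_coeff h)"
      by (auto simp: degree_leads_def)
    then obtain f s where fs: "f \<in> F" "h = pcompose f [:s, 1:] - [:poly f s:] - f1" and "h \<noteq> 0"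
      by (auto simp: G_def)
    show "q \<in> \<phi> ` X \<union> low"
    proof (cases "degree f = d \<and> lead_coeff f = l")
      case True
      then have "degree h < d" using g[OF fs] \<open>h \<noteq> 0\<close> by auto
      then show ?thesis using \<open>q \<in> degree_leads G\<close> h by (auto simp: low_def)
    next
      case False
      then have "q = \<phi> (degree f, lead_coeff f)" using g[OF fs] h by auto
      moreover have "(degree f, lead_coeff f) \<in> X"
        using False fs by (auto simp: X_def degree_leads_def)
      ultimately show ?thesis by blast
    qed
  next
    fix q assume "q \<in> \<phi> ` X \<union> low"
    then show "q \<in> degree_leads G"
    proof
      assume "q \<in> \<phi> ` X"
      then obtain f where f: "f \<in> F" "\<not> (degree f = d \<and> lead_coeff f = l)"
        "q = \<phi> (degree f, lead_coeff f)"
        by (auto simp: X_def degree_leads_def)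
      \<comment> \<open>The shift \<open>0\<close> alone already realises every pair in the image of
        \<open>X\<close>, so the count in degrees from \<open>d\<close> upward is exact.\<close>
      define h where "h = pcompose f [:0, 1:] - [:poly f 0:] - f1"
      have "h \<noteq> 0 \<and> q = (degree h, lead_coeff h)"
        using g[OF f(1) h_def] f(2,3) by auto
      moreover have "h \<in> (\<lambda>(f, s). pcompose f [:s, 1:] - [:poly f s:] - f1) ` (F \<times> S)"
        using f(1) S0 by (intro image_eqI[where x = "(f, 0)"]) (auto simp: h_def)
      ultimately show ?thesis unfolding degree_leads_def G_def by blast
    qed (auto simp: low_def)
  qed
  moreover have "\<phi> ` X \<inter> low = {}"
  proof -
    have "\<forall>q\<in>\<phi> ` X. d \<le> fst q"
      using f1(2) by (auto simp: X_def degree_leads_def \<phi>_def d_def split: if_splits)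
    then show ?thesis by (fastforce simp: low_def)
  qed
  moreover have "finite X" "finite low" using finD by (auto simp: X_def low_def)
  ultimately have "mset_set (degree_leads G) = mset_set (\<phi> ` X) + mset_set low"
    by (simp add: mset_set_Union)
  moreover have "inj_on \<phi> X" by (auto simp: inj_on_def \<phi>_def split: if_splits)
  then have "mset_set (\<phi> ` X) = image_mset \<phi> (mset_set X)"
    by (simp add: image_mset_mset_set)
  moreover have "fst \<circ> \<phi> = fst" by (auto simp: \<phi>_def)
  ultimately have "pet_weight G = image_mset fst (mset_set X) + image_mset fst (mset_set low)"
    by (simp add: pet_weight_def multiset.map_comp)
  moreover have "(d, l) \<in> degree_leads F"
    using f1(1) by (auto simp: degree_leads_def d_def l_def)
  then have "mset_set (degree_leads F) = mset_set X + {#(d, l)#}"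
    unfolding X_def using finD by (simp add: mset_set.remove)
  then have "pet_weight F = image_mset fst (mset_set X) + {#d#}"
    by (simp add: pet_weight_def)
  moreover have "(image_mset fst (mset_set X) + image_mset fst (mset_set low),
      image_mset fst (mset_set X) + {#d#}) \<in> mult less_than"
    using \<open>finite low\<close> by (intro one_step_implies_mult) (auto simp: low_def)
  ultimately show ?thesis by simp
qed

text \<open>Colour focusing with PET induction. The failure set \<open>D\<close> of return times belongs to the
  idempotent \<open>p\<close>, so the increments \<open>\<sigma> j i\<close> between the stages can be kept in it; two stages \<open>j < i\<close>
  of the same colour \<open>h\<close> then contradict the definition of \<open>D\<close>.\<close>

theorem polynomial_recurrence:
  fixes \<Phi> p :: "int filter" and F :: "int poly set"
  assumes inv: "\<And>P t. eventually P \<Phi> \<Longrightarrow> \<forall>\<^sub>F a in \<Phi>. P (a + t)"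
    and cover: "\<And>P. frequently P \<Phi> \<Longrightarrow> \<exists>H. finite H \<and> (\<forall>\<^sub>F a in \<Phi>. \<exists>h\<in>H. P (a + h))"
    and p: "ultrafilter p" "\<And>P. eventually P p \<Longrightarrow> \<forall>\<^sub>F n in p. \<forall>\<^sub>F m in p. P (m + n)"
    and F: "finite F" "\<And>f. f \<in> F \<Longrightarrow> poly f 0 = 0"
    and P: "frequently P \<Phi>"
  shows "\<forall>\<^sub>F n in p. \<exists>\<^sub>F a in \<Phi>. P a \<and> (\<forall>f\<in>F. P (a + poly f n))"
proof -
  have freq_shift: "frequently (\<lambda>a. P (a + t)) \<Phi>" if "frequently P \<Phi>" for P t
  proof (rule ccontr)
    assume "\<not> ?thesis"
    then have "eventually (\<lambda>a. \<not> P (a + t)) \<Phi>" by (simp add: frequently_def)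
    from inv[OF this, of "- t"] show False using that by (simp add: frequently_def)
  qed
  have main: "\<forall>\<^sub>F n in p. \<exists>\<^sub>F a in \<Phi>. P a \<and> (\<forall>f\<in>F. P (a + poly f n))"
    if "finite F" "\<And>f. f \<in> F \<Longrightarrow> poly f 0 = 0" "0 \<notin> F" "frequently P \<Phi>" for P F
    using that
  proof (induction "pet_weight F" arbitrary: F P rule: wf_induct_rule[OF wf_mult[OF wf_less_than]])
    case (1 F)
    note fin = "1.prems"(1) and null = "1.prems"(2) and nz = "1.prems"(3) and freqP = "1.prems"(4)
    show ?case
    proof (cases "F = {}")
      case True
      then show ?thesis using freqP by simp
    next
      case False
      have deg: "degree f > 0" if f: "f \<in> F" for f
      proof (rule ccontr)
        assume "\<not> degree f > 0"
        then obtain c where "f = [:c:]" by (metis degree_eq_zeroE gr0I)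
        then show False using null[OF f] nz f by auto
      qed
      obtain f1 where f1: "f1 \<in> F" "\<And>f. f \<in> F \<Longrightarrow> degree f1 \<le> degree f"
        using ex_has_least_nat[of "\<lambda>f. f \<in> F" _ degree] False by auto
      obtain H where H: "finite H" "\<forall>\<^sub>F a in \<Phi>. \<exists>h\<in>H. P (a + h)"
        using cover[OF freqP] by blast
      show ?thesis
      proof (rule ccontr)
        define D where "D n \<longleftrightarrow> \<not> (\<exists>\<^sub>F a in \<Phi>. P a \<and> (\<forall>f\<in>F. P (a + poly f n)))" for n
        \<comment> \<open>\<open>D'\<close> is the usual star of \<open>D\<close>: it is stable, in
          that \<open>D' n\<close> implies \<open>D' (m + n)\<close> for \<open>p\<close>-most
          \<open>m\<close>.\<close>
        define D' where "D' n \<longleftrightarrow> D n \<and> (\<forall>\<^sub>F m in p. D (m + n))" for n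
        assume "\<not> ?thesis"
        then have D: "eventually D p"
          using ultrafilter_not_iff[OF p(1)] unfolding D_def by blast
        then have evD': "eventually D' p"
          unfolding D'_def using p(2)[OF D] by eventually_elim simp
        have D'_step: "\<forall>\<^sub>F m in p. D' (m + n)" if "D' n" for n
        proof -
          from that have *: "\<forall>\<^sub>F m in p. D (m + n)" by (simp add: D'_def)
          have "\<forall>\<^sub>F m in p. \<forall>\<^sub>F m' in p. D (m' + m + n)" by (rule p(2)[OF *])
          with * show ?thesis unfolding D'_def by eventually_elim (simp add: add_ac)
        qed
        \<comment> \<open>All points of \<open>B i\<close> reach \<open>P\<close> by the single
          shift \<open>h i\<close>, which is the colour of the stage, and every \<open>f\<close> in
          \<open>F\<close>, evaluated at \<open>\<sigma> j i\<close>, moves \<open>B i\<close> into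
          the earlier \<open>B j\<close>.\<close>
        define stage where "stage N B h \<sigma> \<longleftrightarrow>
            (\<forall>i\<le>N. frequently (B i) \<Phi> \<and> h i \<in> H \<and> (\<forall>a. B i a \<longrightarrow> P (a + h i))) \<and>
            (\<forall>i\<le>N. \<forall>j<i. D' (\<sigma> j i) \<and> (\<forall>a. \<forall>f\<in>F. B i a \<longrightarrow> B j (a + poly f (\<sigma> j i))))"
          for N :: nat and B h \<sigma>
        have stageD:
          "\<And>i. i \<le> N \<Longrightarrow> frequently (B i) \<Phi>" "\<And>i. i \<le> N \<Longrightarrow> h i \<in> H"
          "\<And>i a. i \<le> N \<Longrightarrow> B i a \<Longrightarrow> P (a + h i)"
          "\<And>i j. i \<le> N \<Longrightarrow> j < i \<Longrightarrow> D' (\<sigma> j i)"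
          "\<And>i j f a. i \<le> N \<Longrightarrow> j < i \<Longrightarrow> f \<in> F \<Longrightarrow> B i a \<Longrightarrow> B j (a + poly f (\<sigma> j i))"
          if "stage N B h \<sigma>" for N B h \<sigma>
          using that unfolding stage_def by blast+
        have stages: "\<exists>B h \<sigma>. stage N B h \<sigma>" for N
        proof (induction N)
          case 0
          have "frequently (\<lambda>a. \<exists>h\<in>H. P (a + h)) \<Phi>"
            by (rule frequently_rev_mp[OF freqP eventually_mono[OF H(2)]]) auto
          then have "\<exists>h\<in>H. frequently (\<lambda>a. P (a + h)) \<Phi>"
            by (rule frequently_bex_finite[OF H(1)])
          then obtain h where "h \<in> H" "frequently (\<lambda>a. P (a + h)) \<Phi>"
            by blast
          then show ?case
            unfolding stage_def
            by (intro exI[of _ "\<lambda>_ a. P (a + h)"] exI[of _ "\<lambda>_. h"]) auto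
        next
          case (Suc N)
          then obtain B h \<sigma> where "stage N B h \<sigma>" by blast
          note B = stageD(1-3)[OF this] and \<sigma> = stageD(4-5)[OF this]
          \<comment> \<open>The increments from the new stage will be
            \<open>n + \<sigma> j N\<close> for \<open>j < N\<close>, and \<open>n\<close> itself
            for \<open>j = N\<close>; the latter is the reason for \<open>0\<close> in
            \<open>S\<close>. With \<open>s\<close> in \<open>S\<close>, the polynomials in
            \<open>G\<close> have the values \<open>f (s + n) - f s - f1 n\<close>.\<close>
          define S where "S = insert 0 ((\<lambda>j. \<sigma> j N) ` {..<N})"
          define g where "g = (\<lambda>(f, s). pcompose f [:s, 1:] - [:poly f s:] - f1)"
          define G where "G = g ` (F \<times> S) - {0}"
          have poly_g: "poly (g (f, s)) n = poly f (s + n) - poly f s - poly f1 n" for f s n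
            by (simp add: g_def poly_pcompose)
          have "\<forall>\<^sub>F n in p. \<exists>\<^sub>F a in \<Phi>. B N a \<and> (\<forall>q\<in>G. B N (a + poly q n))"
          proof (rule "1.hyps")
            show "(pet_weight G, pet_weight F) \<in> mult less_than"
              unfolding G_def g_def
              by (rule pet_weight_decreases[OF fin _ _ deg f1 null]) (auto simp: S_def)
            show "finite G" using fin by (auto simp: G_def S_def)
            show "poly q 0 = 0" if "q \<in> G" for q
              using that null f1(1) by (auto simp: G_def poly_g)
          qed (auto simp: G_def B)
          moreover have "\<forall>\<^sub>F n in p. \<forall>j\<in>{..<N}. D' (n + \<sigma> j N)"
            using \<sigma>(1) D'_step by (simp add: eventually_ball_finite)
          ultimately have "\<forall>\<^sub>F n in p. (\<exists>\<^sub>F a in \<Phi>. B N a \<and> (\<forall>q\<in>G. B N (a + poly q n))) \<and>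
              (\<forall>j\<in>{..<N}. D' (n + \<sigma> j N)) \<and> D' n"
            using evD' by eventually_elim blast
          then obtain n where n: "\<exists>\<^sub>F a in \<Phi>. B N a \<and> (\<forall>q\<in>G. B N (a + poly q n))"
              "\<And>j. j < N \<Longrightarrow> D' (n + \<sigma> j N)" "D' n"
            using eventually_happens'[OF ultrafilter_neq_bot[OF p(1)]] by blast
          define B' where "B' a \<longleftrightarrow> B N a \<and> (\<forall>q\<in>G. B N (a + poly q n))" for a
          \<comment> \<open>\<open>G\<close> controls displacements relative to \<open>f1 n\<close>,
            so the new base points are the old ones moved back by \<open>f1 n\<close>. Splitting
            them according to a shift into \<open>P\<close> then fixes the new colour.\<close>
          have "frequently (\<lambda>a. B' (a + poly f1 n)) \<Phi>"
            using n(1) unfolding B'_def by (rule freq_shift)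
          then have "frequently (\<lambda>a. \<exists>h\<in>H. B' (a + poly f1 n) \<and> P (a + h)) \<Phi>"
            by (rule frequently_rev_mp[OF _ eventually_mono[OF H(2)]]) auto
          then have "\<exists>h\<in>H. frequently (\<lambda>a. B' (a + poly f1 n) \<and> P (a + h)) \<Phi>"
            by (rule frequently_bex_finite[OF H(1)])
          then obtain hN where hN: "hN \<in> H" "frequently (\<lambda>a. B' (a + poly f1 n) \<and> P (a + hN)) \<Phi>"
            by blast
          define C where "C a \<longleftrightarrow> B' (a + poly f1 n) \<and> P (a + hN)" for a
          define \<sigma>' where "\<sigma>' j = (if j < N then n + \<sigma> j N else n)" for j
          have C_step: "B j (a + poly f (\<sigma>' j))" if "C a" "f \<in> F" "j < Suc N" for j a f
          proof -
            define s where "s = (if j < N then \<sigma> j N else 0)"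
            have "s \<in> S" using that by (auto simp: s_def S_def)
            have B'a: "B' (a + poly f1 n)" using that by (simp add: C_def)
            have "B N (a + poly f1 n + poly (g (f, s)) n)"
            proof (cases "g (f, s) = 0")
              case True
              then show ?thesis using B'a by (simp add: B'_def)
            next
              case False
              then have "g (f, s) \<in> G" using \<open>s \<in> S\<close> that by (auto simp: G_def)
              then show ?thesis using B'a by (simp add: B'_def)
            qed
            then have *: "B N (a + poly f (s + n) - poly f s)" by (simp add: poly_g algebra_simps)
            show ?thesis
            proof (cases "j < N")
              case True
              then show ?thesis
                using \<sigma>(2)[OF order_refl True that(2) *] by (simp add: s_def \<sigma>'_def add_ac)
            next
              case False
              then show ?thesis using * that null[OF that(2)] by (simp add: s_def \<sigma>'_def less_Suc_eq)
            qed
          qed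
          show ?case
            unfolding stage_def
          proof (intro exI conjI allI impI ballI)
            fix i j a f assume "i \<le> Suc N" "j < i"
            show "D' ((if i = Suc N then \<sigma>' j else \<sigma> j i))"
              using \<sigma>(1)[of i j] n \<open>i \<le> Suc N\<close> \<open>j < i\<close> by (auto simp: \<sigma>'_def le_Suc_eq)
            assume "f \<in> F" "(if i = Suc N then C else B i) a"
            then show "(if j = Suc N then C else B j) (a + poly f (if i = Suc N then \<sigma>' j else \<sigma> j i))"
              using C_step \<sigma>(2)[of i j f a] \<open>i \<le> Suc N\<close> \<open>j < i\<close> by (auto simp: le_Suc_eq)
          next
            fix i a assume i: "i \<le> Suc N"
            show "frequently (if i = Suc N then C else B i) \<Phi>"
              using i B(1)[of i] hN(2) by (auto simp: le_Suc_eq C_def[abs_def])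
            show "(if i = Suc N then hN else h i) \<in> H"
              using i B(2)[of i] hN(1) by (auto simp: le_Suc_eq)
            show "P (a + (if i = Suc N then hN else h i))" if "(if i = Suc N then C else B i) a"
              using i B(3)[of i a] that by (auto simp: le_Suc_eq C_def split: if_splits)
          qed
        qed
        \<comment> \<open>The stages are numbered from \<open>0\<close> to \<open>card H\<close>,
          one more than there are colours.\<close>
        obtain B h \<sigma> where "stage (card H) B h \<sigma>" using stages by blast
        note B = stageD(1-3)[OF this] and \<sigma> = stageD(4-5)[OF this]
        have "\<not> inj_on h {..card H}"
          using card_inj_on_le[of h "{..card H}" H] B(2) H(1) by auto
        then obtain i j where ij: "i \<le> card H" "j < i" "h i = h j"
          unfolding inj_on_def by (metis atMost_iff linorder_neqE_nat)
        have "frequently (\<lambda>a. B i (a + (- h i))) \<Phi>"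
          by (rule freq_shift) (rule B(1)[OF ij(1)])
        then have "frequently (\<lambda>a. P a \<and> (\<forall>f\<in>F. P (a + poly f (\<sigma> j i)))) \<Phi>"
        proof (rule frequently_elim1)
          fix a assume a: "B i (a + (- h i))"
          have "P (a + poly f (\<sigma> j i))" if "f \<in> F" for f
            using B(3)[OF _ \<sigma>(2)[OF ij(1,2) that a]] ij by simp
          then show "P a \<and> (\<forall>f\<in>F. P (a + poly f (\<sigma> j i)))"
            using B(3)[OF ij(1) a] by simp
        qed
        moreover have "D (\<sigma> j i)" using \<sigma>(1)[OF ij(1,2)] by (simp add: D'_def)
        ultimately show False by (simp add: D_def)
      qed
    qed
  qed
  have "\<forall>\<^sub>F n in p. \<exists>\<^sub>F a in \<Phi>. P a \<and> (\<forall>f\<in>F-{0}. P (a + poly f n))"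
    using F P by (intro main) auto
  then show ?thesis
  proof eventually_elim
    case (elim n)
    then show ?case
      by (rule frequently_elim1) (metis Diff_iff add.right_neutral poly_0 singletonD)
  qed
qed

text \<open>Maps without constant term in the variables \<open>i < k\<close> all of whose one-variable sections are
  integer polynomials; the recurrence argument uses nothing else about polynomials in several
  variables.\<close>

definition mpoly_fun :: "nat \<Rightarrow> ((nat \<Rightarrow> int) \<Rightarrow> int) \<Rightarrow> bool" where
  "mpoly_fun k g \<longleftrightarrow> g (\<lambda>_. 0) = 0 \<and> (\<forall>y y'. (\<forall>i<k. y i = y' i) \<longrightarrow> g y = g y') \<and>
     (\<forall>y i. \<exists>q :: int poly. \<forall>z. g (y(i := z)) = poly q z)"

section \<open>Polynomial maps given by their sections\<close>

lemma mpoly_fun_zero: "mpoly_fun k g \<Longrightarrow> g (\<lambda>_. 0) = 0"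
  by (simp add: mpoly_fun_def)

lemma mpoly_fun_cong: "mpoly_fun k g \<Longrightarrow> (\<And>i. i < k \<Longrightarrow> y i = y' i) \<Longrightarrow> g y = g y'"
  unfolding mpoly_fun_def by blast

lemma mpoly_fun_section:
  assumes "mpoly_fun k g"
  obtains q :: "int poly" where "\<And>z. g (y(i := z)) = poly q z"
  using assms unfolding mpoly_fun_def by meson

lemma mpoly_fun_mono: "mpoly_fun k g \<Longrightarrow> k \<le> k' \<Longrightarrow> mpoly_fun k' g"
  unfolding mpoly_fun_def by (meson order_less_le_trans)

lemma mpoly_fun_add:
  assumes "mpoly_fun k g" "mpoly_fun k h"
  shows "mpoly_fun k (\<lambda>y. g y + h y)"
  unfolding mpoly_fun_def
proof (intro conjI allI impI)
  fix y :: "nat \<Rightarrow> int" and i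
  obtain q r where "\<And>z. g (y(i := z)) = poly q z" "\<And>z. h (y(i := z)) = poly r z"
    using mpoly_fun_section assms by metis
  then show "\<exists>q. \<forall>z. g (y(i := z)) + h (y(i := z)) = poly q z"
    by (intro exI[of _ "q + r"]) simp
next
  fix y y' :: "nat \<Rightarrow> int" assume "\<forall>i<k. y i = y' i"
  then show "g y + h y = g y' + h y'" using mpoly_fun_cong assms by metis
qed (simp add: assms[THEN mpoly_fun_zero])

lemma mpoly_fun_cmult:
  assumes "mpoly_fun k g"
  shows "mpoly_fun k (\<lambda>y. c * g y)"
  unfolding mpoly_fun_def
proof (intro conjI allI impI)
  fix y :: "nat \<Rightarrow> int" and i
  obtain q where "\<And>z. g (y(i := z)) = poly q z"
    using mpoly_fun_section assms by metis
  then show "\<exists>q. \<forall>z. c * g (y(i := z)) = poly q z"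
    by (intro exI[of _ "smult c q"]) simp
next
  fix y y' :: "nat \<Rightarrow> int" assume "\<forall>i<k. y i = y' i"
  then show "c * g y = c * g y'" using mpoly_fun_cong assms by metis
qed (simp add: assms[THEN mpoly_fun_zero])

lemma mpoly_fun_diff: "mpoly_fun k g \<Longrightarrow> mpoly_fun k h \<Longrightarrow> mpoly_fun k (\<lambda>y. g y - h y)"
  using mpoly_fun_add[of k g "\<lambda>y. -1 * h y"] mpoly_fun_cmult[of k h "-1"] by simp

lemma mpoly_fun_var: "j < k \<Longrightarrow> mpoly_fun k (\<lambda>y. y j)"
  unfolding mpoly_fun_def
proof (intro conjI allI impI)
  fix y :: "nat \<Rightarrow> int" and i
  show "\<exists>q. \<forall>z. (y(i := z)) j = poly q z"
    by (cases "i = j") (auto intro: exI[of _ "[:0, 1:]"] exI[of _ "[:y j:]"])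
qed auto

lemma mpoly_fun_sum:
  "finite S \<Longrightarrow> (\<And>s. s \<in> S \<Longrightarrow> mpoly_fun k (g s)) \<Longrightarrow> mpoly_fun k (\<lambda>y. \<Sum>s\<in>S. g s y)"
proof (induction S rule: finite_induct)
  case empty
  show ?case by (auto simp: mpoly_fun_def intro: exI[of _ 0])
next
  case (insert s S)
  then show ?case using mpoly_fun_add by simp
qed

text \<open>Replacing the coordinates of the origin one at a time by multiples of \<open>c\<close>
  changes the value by a multiple of \<open>c\<close> each time, since sections are integer
  polynomials. The same divisibility applies to the constant term of a section, so the quotient has
  integer polynomial sections again.\<close>

lemma mpoly_fun_scale:
  assumes g: "mpoly_fun k g" and c: "c \<noteq> 0"
  shows "c dvd g (\<lambda>i. c * z i)" "mpoly_fun k (\<lambda>z. g (\<lambda>i. c * z i) div c)"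
proof -
  have dvd: "c dvd g (\<lambda>i. c * z i)" for z
  proof -
    have "c dvd g (\<lambda>i. if i < t then c * z i else 0)" for t
    proof (induction t)
      case 0
      then show ?case using mpoly_fun_zero[OF g] by simp
    next
      case (Suc t)
      define u where "u = (\<lambda>i. if i < t then c * z i else 0)"
      obtain q where q: "\<And>x. g (u(t := x)) = poly q x" using mpoly_fun_section[OF g] by metis
      have "u(t := 0) = u" by (auto simp: u_def)
      then have "c dvd poly q 0" using Suc q[of 0] by (simp add: u_def)
      moreover have "c dvd poly q (c * z t) - poly q 0" by (cases q) simp
      ultimately have "c dvd (poly q (c * z t) - poly q 0) + poly q 0" by (rule dvd_add[rotated])
      then have "c dvd g (u(t := c * z t))" by (simp add: q)
      moreover have "u(t := c * z t) = (\<lambda>i. if i < Suc t then c * z i else 0)"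
        by (auto simp: u_def less_Suc_eq)
      ultimately show ?case by simp
    qed
    from this[of k] have "c dvd g (\<lambda>i. if i < k then c * z i else 0)" .
    also have "g (\<lambda>i. if i < k then c * z i else 0) = g (\<lambda>i. c * z i)"
      by (rule mpoly_fun_cong[OF g]) simp
    finally show ?thesis .
  qed
  then show "c dvd g (\<lambda>i. c * z i)" .
  show "mpoly_fun k (\<lambda>z. g (\<lambda>i. c * z i) div c)"
    unfolding mpoly_fun_def
  proof (intro conjI allI impI)
    fix y :: "nat \<Rightarrow> int" and i
    obtain q where q: "\<And>x. g ((\<lambda>i. c * y i)(i := x)) = poly q x"
      using mpoly_fun_section[OF g] by metis
    have eq: "(\<lambda>j. c * (y(i := x)) j) = (\<lambda>i. c * y i)(i := c * x)" for x by auto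
    obtain a r where qr: "q = pCons a r" by (cases q)
    have "c dvd a" using dvd[of "y(i := 0)"] unfolding eq q by (simp add: qr)
    then obtain b where b: "a = c * b" by auto
    have "(a + c * x * poly r (c * x)) div c = b + x * poly r (c * x)" for x
    proof -
      have "a + c * x * poly r (c * x) = c * (b + x * poly r (c * x))"
        by (simp add: b algebra_simps)
      then show ?thesis using c by simp
    qed
    then show "\<exists>q. \<forall>z. g (\<lambda>j. c * (y(i := z)) j) div c = poly q z"
      unfolding eq q by (intro exI[of _ "pCons b (pcompose r [:0, c:])"])
        (simp add: qr poly_pcompose mult.assoc mult.commute[of _ c])
  next
    fix y y' :: "nat \<Rightarrow> int" assume "\<forall>i<k. y i = y' i"
    then have "g (\<lambda>i. c * y i) = g (\<lambda>i. c * y' i)" by (intro mpoly_fun_cong[OF g]) simp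
    then show "g (\<lambda>i. c * y i) div c = g (\<lambda>i. c * y' i) div c" by simp
  qed (simp add: mpoly_fun_zero[OF g])
qed

lemma mpoly_fun_section_roots:
  assumes "mpoly_fun k g" "g v \<noteq> 0"
  shows "finite {x. g (v(i := x)) = 0}"
proof -
  obtain q where q: "\<And>x. g (v(i := x)) = poly q x" using mpoly_fun_section[OF assms(1)] by metis
  have "poly q (v i) \<noteq> 0" using q[of "v i"] assms(2) by simp
  then have "q \<noteq> 0" by auto
  then show ?thesis by (simp add: q poly_roots_finite)
qed

text \<open>A section that is not zero has finitely many roots, hence some multiple of
  \<open>c\<close> avoids them; the variables are treated one after the other. Putting
  \<open>0\<close> from index \<open>k\<close> on lets linear terms in further variables vanish when
  the result is applied.\<close>

lemma mpoly_fun_nonzero_at_multiples: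
  assumes g: "mpoly_fun k g" and v: "g v \<noteq> 0" and c: "c \<noteq> 0"
  obtains z where "g (\<lambda>i. c * z i) \<noteq> 0" "\<And>i. i \<ge> k \<Longrightarrow> z i = 0"
proof -
  have "\<exists>v. g v \<noteq> 0 \<and> (\<forall>i<t. c dvd v i)" for t
  proof (induction t)
    case (Suc t)
    then obtain v where v: "g v \<noteq> 0" "\<forall>i<t. c dvd v i" by blast
    have "inj ((*) c)" using c by (simp add: inj_def)
    then have "infinite (range ((*) c))" using finite_imageD infinite_UNIV_int by blast
    then have "\<not> range ((*) c) \<subseteq> {x. g (v(t := x)) = 0}"
      using mpoly_fun_section_roots[OF g v(1)] finite_subset by metis
    then obtain x where "g (v(t := c * x)) \<noteq> 0" by auto
    moreover have "\<forall>i<Suc t. c dvd (v(t := c * x)) i" using v(2) by (simp add: less_Suc_eq)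
    ultimately show ?case by blast
  qed (use v in auto)
  then obtain v where v: "g v \<noteq> 0" "\<forall>i<k. c dvd v i" by blast
  define z where "z i = (if i < k then v i div c else 0)" for i
  have "g (\<lambda>i. c * z i) = g v"
    using v by (intro mpoly_fun_cong[OF g]) (simp add: z_def)
  then show thesis using v by (intro that[of z]) (auto simp: z_def)
qed

text \<open>The variables are chosen one after the other. Every non-zero \<open>r \<in> R\<close> keeps a non-zero value
  compatible with the choices made so far, because a section that is not zero has finitely many
  roots.\<close>

theorem multivariate_polynomial_recurrence:
  fixes \<Phi> p :: "int filter"
  assumes inv: "\<And>P t. eventually P \<Phi> \<Longrightarrow> \<forall>\<^sub>F a in \<Phi>. P (a + t)"
    and cover: "\<And>P. frequently P \<Phi> \<Longrightarrow> \<exists>H. finite H \<and> (\<forall>\<^sub>F a in \<Phi>. \<exists>h\<in>H. P (a + h))"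
    and p: "ultrafilter p" "\<And>P. eventually P p \<Longrightarrow> \<forall>\<^sub>F n in p. \<forall>\<^sub>F m in p. P (m + n)"
    and nonprincipal: "\<And>x0. \<forall>\<^sub>F x in p. x \<noteq> x0"
    and F: "finite F" "\<And>f. f \<in> F \<Longrightarrow> mpoly_fun m f"
    and R: "finite R" "\<And>r. r \<in> R \<Longrightarrow> mpoly_fun m r" "\<And>r. r \<in> R \<Longrightarrow> \<exists>v. r v \<noteq> 0"
    and B: "eventually B p"
    and P: "frequently P \<Phi>"
  shows "\<exists>z. (\<forall>i<m. B (z i)) \<and> (\<forall>r\<in>R. r z \<noteq> 0) \<and>
    (\<exists>\<^sub>F a in \<Phi>. P a \<and> (\<forall>f\<in>F. P (a + f z)))"
proof -
  have "\<exists>z. (\<forall>i<t. B (z i)) \<and> (\<forall>i\<ge>t. z i = 0) \<and>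
      (\<forall>r\<in>R. \<exists>v. (\<forall>i<t. v i = z i) \<and> r v \<noteq> 0) \<and>
      (\<exists>\<^sub>F a in \<Phi>. P a \<and> (\<forall>f\<in>F. P (a + f z)))" for t
  proof (induction t)
    case 0
    have "\<exists>\<^sub>F a in \<Phi>. P a \<and> (\<forall>f\<in>F. P (a + f (\<lambda>_. 0)))"
      by (rule frequently_elim1[OF P]) (simp add: mpoly_fun_zero[OF F(2)])
    then show ?case
      using R(3) by (intro exI[of _ "\<lambda>_. 0"]) simp
  next
    case (Suc t)
    then obtain z where z: "\<forall>i<t. B (z i)" "\<forall>i\<ge>t. z i = 0"
      and zR: "\<forall>r\<in>R. \<exists>v. (\<forall>i<t. v i = z i) \<and> r v \<noteq> 0"
      and zP: "\<exists>\<^sub>F a in \<Phi>. P a \<and> (\<forall>f\<in>F. P (a + f z))" by blast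
    obtain v where v: "\<And>r. r \<in> R \<Longrightarrow> (\<forall>i<t. v r i = z i) \<and> r (v r) \<noteq> 0"
      using bchoice[OF zR] by blast
    have "\<exists>q. \<forall>x. f (z(t := x)) = poly q x" if "f \<in> F" for f
      using mpoly_fun_section[OF F(2)[OF that]] by metis
    then obtain q0 where q0: "\<And>f x. f \<in> F \<Longrightarrow> f (z(t := x)) = poly (q0 f) x" by metis
    \<comment> \<open>Since \<open>z t = 0\<close> so far, subtracting \<open>f z\<close> makes the
      section vanish at \<open>0\<close>, as one-variable recurrence demands. That recurrence is
      applied to the set of those \<open>a\<close> which already have all the returns
      \<open>a + f z\<close>.\<close>
    define q where "q f = q0 f - [:f z:]" for f
    have q: "poly (q f) x = f (z(t := x)) - f z" if "f \<in> F" for f x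
      using q0[OF that] by (simp add: q_def)
    have zt: "z(t := 0) = z" using z(2) by auto
    have "\<forall>\<^sub>F x in p. \<exists>\<^sub>F a in \<Phi>. (P a \<and> (\<forall>f\<in>F. P (a + f z))) \<and>
        (\<forall>h\<in>q ` F. P (a + poly h x) \<and> (\<forall>f\<in>F. P (a + poly h x + f z)))"
      by (rule polynomial_recurrence[OF inv cover p _ _ zP]) (use F q zt in auto)
    moreover have "\<forall>\<^sub>F x in p. \<forall>r\<in>R. r ((v r)(t := x)) \<noteq> 0"
    proof (rule eventually_ball_finite[OF R(1)], rule ballI)
      fix r assume r: "r \<in> R"
      have "finite {x. r ((v r)(t := x)) = 0}"
        using mpoly_fun_section_roots[OF R(2)] v r by blast
      then have "\<forall>\<^sub>F x in p. \<forall>x0\<in>{x. r ((v r)(t := x)) = 0}. x \<noteq> x0"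
        by (intro eventually_ball_finite) (auto simp: nonprincipal)
      then show "\<forall>\<^sub>F x in p. r ((v r)(t := x)) \<noteq> 0" by eventually_elim blast
    qed
    ultimately have "\<forall>\<^sub>F x in p. B x \<and> (\<forall>r\<in>R. r ((v r)(t := x)) \<noteq> 0) \<and>
      (\<exists>\<^sub>F a in \<Phi>. (P a \<and> (\<forall>f\<in>F. P (a + f z))) \<and>
        (\<forall>h\<in>q ` F. P (a + poly h x) \<and> (\<forall>f\<in>F. P (a + poly h x + f z))))"
      using B by eventually_elim blast
    then obtain x where x: "B x" "\<And>r. r \<in> R \<Longrightarrow> r ((v r)(t := x)) \<noteq> 0"
      "\<exists>\<^sub>F a in \<Phi>. (P a \<and> (\<forall>f\<in>F. P (a + f z))) \<and>
        (\<forall>h\<in>q ` F. P (a + poly h x) \<and> (\<forall>f\<in>F. P (a + poly h x + f z)))"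
      using eventually_happens'[OF ultrafilter_neq_bot[OF p(1)]] by blast
    have "\<exists>\<^sub>F a in \<Phi>. P a \<and> (\<forall>f\<in>F. P (a + f (z(t := x))))"
    proof (rule frequently_elim1[OF x(3)])
      fix a assume a: "(P a \<and> (\<forall>f\<in>F. P (a + f z))) \<and>
        (\<forall>h\<in>q ` F. P (a + poly h x) \<and> (\<forall>f\<in>F. P (a + poly h x + f z)))"
      have "P (a + f (z(t := x)))" if "f \<in> F" for f
      proof -
        have "P (a + poly (q f) x + f z)" using a that by blast
        then show ?thesis by (simp add: q[OF that])
      qed
      then show "P a \<and> (\<forall>f\<in>F. P (a + f (z(t := x))))" using a by blast
    qed
    moreover have "\<exists>v'. (\<forall>i<Suc t. v' i = (z(t := x)) i) \<and> r v' \<noteq> 0" if "r \<in> R" for r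
      using x(2) v that by (intro exI[of _ "(v r)(t := x)"]) (auto simp: less_Suc_eq)
    moreover have "\<forall>i<Suc t. B ((z(t := x)) i)" "\<forall>i\<ge>Suc t. (z(t := x)) i = 0"
      using z x(1) by (auto simp: less_Suc_eq)
    ultimately show ?case by blast
  qed
  from this[of m] obtain z where z: "\<forall>i<m. B (z i)"
    "\<forall>r\<in>R. \<exists>v. (\<forall>i<m. v i = z i) \<and> r v \<noteq> 0"
    "\<exists>\<^sub>F a in \<Phi>. P a \<and> (\<forall>f\<in>F. P (a + f z))" by blast
  have "r z \<noteq> 0" if "r \<in> R" for r
    using z(2) that mpoly_fun_cong[OF R(2)[OF that]] by metis
  then show ?thesis using z by blast
qed

section \<open>Rado equations in members of additive idempotents\<close>

text \<open>Every idempotent lives on the multiples of \<open>c\<close>, since its image in \<open>\<int>/c\<close> is an idempotent.\<close>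

lemma eventually_idempotent_dvd:
  fixes p :: "int filter"
  assumes p: "ultrafilter p" "\<And>P. eventually P p \<Longrightarrow> \<forall>\<^sub>F n in p. \<forall>\<^sub>F m in p. P (m + n)"
    and c: "c \<noteq> 0"
  shows "\<forall>\<^sub>F n in p. c dvd n"
proof -
  have "\<forall>\<^sub>F n in p. \<exists>r\<in>{0..<\<bar>c\<bar>}. n mod \<bar>c\<bar> = r" using c by (intro always_eventually) simp
  from eventually_ultrafilter_finite_Ex[OF p(1) _ this]
  obtain r where r: "\<forall>\<^sub>F n in p. n mod \<bar>c\<bar> = r" by auto
  have "\<forall>\<^sub>F n in p. n mod \<bar>c\<bar> = r \<and> (\<forall>\<^sub>F m in p. m mod \<bar>c\<bar> = r \<and> (m + n) mod \<bar>c\<bar> = r)"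
    using r p(2)[OF r] by eventually_elim (simp add: eventually_conj_iff r)
  then obtain n where n: "n mod \<bar>c\<bar> = r" "\<forall>\<^sub>F m in p. m mod \<bar>c\<bar> = r \<and> (m + n) mod \<bar>c\<bar> = r"
    using eventually_happens'[OF ultrafilter_neq_bot[OF p(1)]] by blast
  then obtain m where "m mod \<bar>c\<bar> = r" "(m + n) mod \<bar>c\<bar> = r"
    using eventually_happens'[OF ultrafilter_neq_bot[OF p(1)]] by blast
  then have "(m + n) mod \<bar>c\<bar> = m mod \<bar>c\<bar>" by simp
  then have "\<bar>c\<bar> dvd n" by (simp add: mod_eq_dvd_iff)
  then have "r = 0" using n(1) by (simp add: mod_eq_0_iff_dvd)
  then show ?thesis using r by (simp add: mod_eq_0_iff_dvd)
qed

text \<open>One index \<open>j0\<close> is exempt from injectivity because equations such as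
  \<open>x 0 - x 1 = 0\<close> force equal values. If \<open>f\<close> is not identically zero, its
  variables serve to separate the exempt value too, whence the last clause.\<close>

definition rado_solution ::
  "nat set \<Rightarrow> nat \<Rightarrow> (nat \<Rightarrow> int) \<Rightarrow> nat \<Rightarrow> ((nat \<Rightarrow> int) \<Rightarrow> int) \<Rightarrow>
     (nat \<Rightarrow> nat) \<Rightarrow> (nat \<Rightarrow> nat) \<Rightarrow> bool" where
  "rado_solution A n c k f x y \<longleftrightarrow> x ` {..<n} \<subseteq> A \<and> y ` {..<k} \<subseteq> A \<and>
     (\<Sum>i<n. c i * int (x i)) + f (\<lambda>i. int (y i)) = 0 \<and>
     (\<exists>j0<n. inj_on x ({..<n} - {j0})) \<and> inj_on y {..<k} \<and>
     ((\<exists>v. f v \<noteq> 0) \<longrightarrow> inj_on x {..<n} \<and> x ` {..<n} \<inter> y ` {..<k} = {})"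

text \<open>Quantifying over \<open>mpoly_fun\<close> makes it possible to divide by
  \<open>N\<close> after a dilation without computing coefficients.\<close>

definition rado_solvable :: "nat set \<Rightarrow> bool" where
  "rado_solvable A \<longleftrightarrow>
     (\<forall>n c k J f. J \<subseteq> {..<n} \<and> J \<noteq> {} \<and> (\<forall>j\<in>J. c j \<noteq> 0) \<and> (\<Sum>j\<in>J. c j) = 0 \<and>
        mpoly_fun k f \<longrightarrow> (\<exists>x y. rado_solution A n c k f x y))"

text \<open>With \<open>w\<^sub>i\<close> from \<open>A\<close> divisible by \<open>c = c\<^sub>j\<^sub>0\<close>, put \<open>y\<^sub>i = w\<^sub>i\<close>, \<open>x\<^sub>i = w\<^sub>k\<^sub>+\<^sub>i\<close> for \<open>i \<notin> J\<close>, and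
  \<open>x\<^sub>j = a + t\<^sub>j\<close> for \<open>j \<in> J\<close>, where the displacements \<open>t\<^sub>j\<close> are distinct multiples of the extra
  variable \<open>w\<^sub>k\<^sub>+\<^sub>n\<close> for \<open>j \<noteq> j0\<close>, and \<open>t\<^sub>j\<^sub>0\<close> is determined by the equation.\<close>

lemma idempotent_rado_solvable:
  fixes \<Phi> :: "int filter" and p :: "nat filter"
  assumes inv: "\<And>P t. eventually P \<Phi> \<Longrightarrow> \<forall>\<^sub>F a in \<Phi>. P (a + t)"
    and cover: "\<And>P. frequently P \<Phi> \<Longrightarrow> \<exists>H. finite H \<and> (\<forall>\<^sub>F a in \<Phi>. \<exists>h\<in>H. P (a + h))"
    and p: "ultrafilter p" "p \<oplus>\<^sub>\<beta> p = p"
    and top: "\<Phi> \<le> at_top" and le: "filtermap int p \<le> \<Phi>"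
    and A: "\<forall>\<^sub>F n in p. n \<in> A"
  shows "rado_solvable A"
  unfolding rado_solvable_def
proof (intro allI impI, elim conjE)
  fix n k J f and c :: "nat \<Rightarrow> int"
  assume J: "J \<subseteq> {..<n}" "J \<noteq> {}" and cJ: "\<forall>j\<in>J. c j \<noteq> 0" "(\<Sum>j\<in>J. c j) = 0" and f: "mpoly_fun k f"
  have finJ: "finite J" using J finite_subset by blast
  obtain j0 where j0: "j0 \<in> J" using J by blast
  define C where "C = c j0"
  have C: "C \<noteq> 0" using cJ j0 by (simp add: C_def)
  define pZ where "pZ = filtermap int p"
  have pZ: "ultrafilter pZ" unfolding pZ_def by (rule ultrafilter_filtermap[OF p(1)])
  have idem: "\<forall>\<^sub>F n in pZ. \<forall>\<^sub>F m in pZ. P (m + n)" if "eventually P pZ" for P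
  proof -
    have "eventually (\<lambda>n. P (int n)) (p \<oplus>\<^sub>\<beta> p)" using that by (simp add: p pZ_def eventually_filtermap)
    then show ?thesis by (simp add: uf_plus_def eventually_uf_op pZ_def eventually_filtermap)
  qed
  have dvd: "\<forall>\<^sub>F x in pZ. C dvd x" by (rule eventually_idempotent_dvd[OF pZ idem C])
  have pZtop: "\<forall>\<^sub>F x in pZ. x > M" for M
    using top le unfolding pZ_def by (meson eventually_gt_at_top filter_leD)
  have pZA: "\<forall>\<^sub>F x in pZ. x \<in> int ` A"
    using A by (simp add: pZ_def eventually_filtermap inj_image_mem_iff)
  \<comment> \<open>Division by \<open>C\<close> is additive on multiples of \<open>C\<close>, so
    \<open>q\<close> inherits idempotence. Writing the variables as \<open>C * z\<close> makes the
    remaining terms divisible by the coefficient \<open>C\<close> of the dependent variable.\<close>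
  define q where "q = filtermap (\<lambda>x. x div C) pZ"
  have evq: "eventually P q \<longleftrightarrow> (\<forall>\<^sub>F x in pZ. P (x div C))" for P
    by (simp add: q_def eventually_filtermap)
  have q: "ultrafilter q" unfolding q_def by (rule ultrafilter_filtermap[OF pZ])
  have q_idem: "\<forall>\<^sub>F n in q. \<forall>\<^sub>F m in q. P (m + n)" if "eventually P q" for P
  proof -
    have "\<forall>\<^sub>F n in pZ. \<forall>\<^sub>F m in pZ. P ((m + n) div C)"
      using idem[of "\<lambda>x. P (x div C)"] that by (simp add: evq)
    with dvd show ?thesis
      unfolding evq
    proof eventually_elim
      case (elim n)
      from elim(2) show ?case by eventually_elim (use elim(1) in \<open>simp add: div_plus_div_distrib_dvd_right\<close>)
    qed
  qed
  have q_nonprincipal: "\<forall>\<^sub>F x in q. x \<noteq> x0" for x0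
    unfolding evq using dvd pZtop[of "C * x0"] by eventually_elim auto

  define Q where "Q w = f w + (\<Sum>i\<in>{..<n} - J. c i * w (k + i))" for w
  have Q: "mpoly_fun (k + n) Q"
    unfolding Q_def
    by (intro mpoly_fun_add mpoly_fun_sum mpoly_fun_cmult mpoly_fun_var)
       (auto intro: mpoly_fun_mono[OF f])
  define h where "h z = Q (\<lambda>i. C * z i) div C" for z
  have h: "mpoly_fun (k + n) h" unfolding h_def by (rule mpoly_fun_scale(2)[OF Q C])
  have Ch: "C * h z = Q (\<lambda>i. C * z i)" for z
    unfolding h_def using mpoly_fun_scale(1)[OF Q C] by simp
  define m where "m = Suc (k + n)"
  \<comment> \<open>\<open>E\<close> compensates the spreading terms: for
    \<open>j \<noteq> j0\<close> the displacement carries an extra factor \<open>C\<close>, so the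
    weighted sum of these terms can be cancelled by the variable with coefficient \<open>C\<close>.
    The multipliers \<open>int j\<close> make the displacements distinct.\<close>
  define E where "E = - (\<Sum>j\<in>J - {j0}. c j * int j)"
  define t where "t j z = (if j = j0 then E * (C * z (k + n)) - h z else C * int j * (C * z (k + n)))"
    for j z
  have t: "mpoly_fun m (t j)" for j
  proof (cases "j = j0")
    case True
    have "mpoly_fun m (\<lambda>z. E * (C * z (k + n)) - h z)"
      by (intro mpoly_fun_diff mpoly_fun_cmult mpoly_fun_var mpoly_fun_mono[OF h]) (auto simp: m_def)
    then show ?thesis using True by (simp add: t_def[abs_def])
  next
    case False
    have "mpoly_fun m (\<lambda>z. C * int j * (C * z (k + n)))"
      by (intro mpoly_fun_cmult mpoly_fun_var) (auto simp: m_def)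
    then show ?thesis using False by (simp add: t_def[abs_def])
  qed
  have t_sum: "(\<Sum>j\<in>J. c j * t j z) = - Q (\<lambda>i. C * z i)" for z
  proof -
    have "(\<Sum>j\<in>J. c j * t j z) = C * t j0 z + (\<Sum>j\<in>J - {j0}. c j * t j z)"
      using finJ j0 by (simp add: sum.remove C_def)
    also have "(\<Sum>j\<in>J - {j0}. c j * t j z) = (\<Sum>j\<in>J - {j0}. c j * int j) * (C * (C * z (k + n)))"
      unfolding sum_distrib_right by (intro sum.cong) (auto simp: t_def)
    also have "\<dots> = - E * (C * (C * z (k + n)))" by (simp add: E_def)
    also have "C * t j0 z = C * E * (C * z (k + n)) - Q (\<lambda>i. C * z i)"
      unfolding Ch[symmetric] by (simp add: t_def algebra_simps)
    finally show ?thesis by (simp add: algebra_simps)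
  qed
  define R1 :: "((nat \<Rightarrow> int) \<Rightarrow> int) set" where
    "R1 = (\<lambda>(i, j) z. z i - z j) ` {(i, j). i < m \<and> j < m \<and> i \<noteq> j}"
  define R2 where "R2 = (\<lambda>j z. t j0 z - t j z) ` (J - {j0})"
  \<comment> \<open>\<open>t j0\<close> may coincide identically with another \<open>t j\<close>, as
    happens for \<open>x 0 - x 1 = 0\<close>; a non-zero difference is therefore demanded only if
    \<open>f\<close> is not identically zero.\<close>
  define R where "R = R1 \<union> {r \<in> R2. \<exists>v. f v \<noteq> 0}"
  have finR: "finite R"
  proof -
    have "finite {(i, j). i < m \<and> j < m \<and> i \<noteq> j}"
      by (rule finite_subset[of _ "{..<m} \<times> {..<m}"]) auto
    then show ?thesis using finJ by (simp add: R_def R1_def R2_def)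
  qed
  have R_mpoly: "mpoly_fun m r" if "r \<in> R" for r
    using that by (auto simp: R_def R1_def R2_def intro!: mpoly_fun_diff mpoly_fun_var t)
  have R_nz: "\<exists>v. r v \<noteq> 0" if r: "r \<in> R" for r
  proof -
    consider "r \<in> R1" | "\<exists>v. f v \<noteq> 0" "r \<in> R2"
      using r unfolding R_def by blast
    then show ?thesis
    proof cases
      case 1
      then obtain i j where "i \<noteq> j" "r = (\<lambda>z. z i - z j)" by (auto simp: R1_def)
      then show ?thesis by (intro exI[of _ "\<lambda>l. if l = i then 1 else 0"]) auto
    next
      case 2
      then obtain j where j: "j \<in> J - {j0}" "r = (\<lambda>z. t j0 z - t j z)" by (auto simp: R2_def)
      have rj: "r z = (E - C * int j) * (C * z (k + n)) - h z" for z
        using j by (simp add: t_def algebra_simps)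
      show ?thesis
      proof (cases "E = C * int j")
        case False
        define v where "v = (\<lambda>l. if l = k + n then 1 else 0 :: int)"
        have "h v = h (\<lambda>_. 0)" by (rule mpoly_fun_cong[OF h]) (simp add: v_def)
        then have "r v = (E - C * int j) * C" using mpoly_fun_zero[OF h] by (simp add: rj v_def)
        then show ?thesis using False C by (intro exI[of _ v]) auto
      next
        \<comment> \<open>Here the extra variable drops out and \<open>r\<close> is
          \<open>- h\<close>, which the variables of \<open>f\<close> alone can make
          non-zero.\<close>
        case True
        obtain v where "f v \<noteq> 0" using 2 by blast
        then obtain z where z: "f (\<lambda>i. C * z i) \<noteq> 0" "\<And>i. i \<ge> k \<Longrightarrow> z i = 0"
          using mpoly_fun_nonzero_at_multiples[OF f _ C] by blast
        have "C * h z \<noteq> 0" using z by (simp add: Ch Q_def)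
        then have "r z \<noteq> 0" using True by (simp add: rj)
        then show ?thesis by blast
      qed
    qed
  qed
  have freqA: "\<exists>\<^sub>F a in \<Phi>. a \<in> int ` A"
  proof (rule ccontr)
    assume "\<not> ?thesis"
    then have "\<forall>\<^sub>F x in pZ. x \<notin> int ` A"
      using le unfolding pZ_def frequently_def by (auto dest: filter_leD)
    then show False using pZA ultrafilter_not_iff[OF pZ] by blast
  qed
  have evB: "\<forall>\<^sub>F x in q. x \<noteq> 0 \<and> C * x \<in> int ` A"
    unfolding evq using q_nonprincipal[of 0, unfolded evq] dvd pZA by eventually_elim auto
  have "\<exists>z. (\<forall>i<m. z i \<noteq> 0 \<and> C * z i \<in> int ` A) \<and> (\<forall>r\<in>R. r z \<noteq> 0) \<and>
      (\<exists>\<^sub>F a in \<Phi>. a \<in> int ` A \<and> (\<forall>g\<in>t ` J. a + g z \<in> int ` A))"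
    by (rule multivariate_polynomial_recurrence[OF inv cover q q_idem q_nonprincipal _ _
          finR R_mpoly R_nz evB freqA])
       (use finJ t in auto)
  then obtain z where zA: "\<And>i. i < m \<Longrightarrow> z i \<noteq> 0 \<and> C * z i \<in> int ` A"
    and zR: "\<And>r. r \<in> R \<Longrightarrow> r z \<noteq> 0"
    and zf: "\<exists>\<^sub>F a in \<Phi>. a \<in> int ` A \<and> (\<forall>g\<in>t ` J. a + g z \<in> int ` A)"
    by blast
  \<comment> \<open>A base point beyond \<open>M\<close> puts every variable with index in
    \<open>J\<close> above all the others, so the two groups never meet.\<close>
  define M where "M = (\<Sum>i<m. \<bar>C * z i\<bar>) + (\<Sum>j\<in>J. \<bar>t j z\<bar>)"
  have "\<forall>\<^sub>F a in \<Phi>. a > M" using top by (meson eventually_gt_at_top filter_leD)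
  then obtain a where a: "a > M" "\<And>j. j \<in> J \<Longrightarrow> a + t j z \<in> int ` A"
    using frequently_eventually_frequently[OF zf, THEN frequently_ex] by blast
  have big: "a + t j z > C * z i" if "j \<in> J" "i < m" for i j
  proof -
    have "\<bar>C * z i\<bar> \<le> (\<Sum>i<m. \<bar>C * z i\<bar>)" using that by (intro member_le_sum) auto
    moreover have "\<bar>t j z\<bar> \<le> (\<Sum>j\<in>J. \<bar>t j z\<bar>)" using that finJ by (intro member_le_sum) auto
    ultimately show ?thesis using a(1) unfolding M_def by linarith
  qed
  define X where "X i = (if i \<in> J then a + t i z else C * z (k + i))" for i
  define x where "x i = nat (X i)" for i
  define y where "y i = (if i < k then nat (C * z i) else 0)" for i
  have XA: "X i \<in> int ` A" if "i < n" for i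
    using that a zA by (auto simp: X_def m_def)
  have intx: "int (x i) = X i" if "i < n" for i using XA[OF that] by (auto simp: x_def)
  have inty: "int (y i) = C * z i" if "i < k" for i
    using zA[of i] that by (auto simp: y_def m_def)
  have zinj: "z i \<noteq> z j" if "i < m" "j < m" "i \<noteq> j" for i j
  proof -
    have "(\<lambda>z. z i - z j) \<in> R" using that by (force simp: R_def R1_def)
    from zR[OF this] show ?thesis by simp
  qed
  have X_out: "X i \<noteq> X j" if "i < n" "j < n" "i \<noteq> j" "i \<notin> J" for i j
    using big[of j "k + i"] that zinj[of "k + i" "k + j"] C by (auto simp: X_def m_def)
  have X_in: "X i \<noteq> X j" if "i \<in> J - {j0}" "j \<in> J - {j0}" "i \<noteq> j" for i j
    using that C zA[of "k + n"] by (auto simp: X_def t_def m_def)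
  have X_inj: "inj_on X ({..<n} - {j0})"
  proof (rule inj_onI, rule ccontr)
    fix i j assume ij: "i \<in> {..<n} - {j0}" "j \<in> {..<n} - {j0}" "X i = X j" "i \<noteq> j"
    show False
    proof (cases "i \<in> J \<and> j \<in> J")
      case True
      then show ?thesis using X_in[of i j] ij by auto
    next
      case False
      then show ?thesis using X_out[of i j] X_out[of j i] ij by auto
    qed
  qed
  have "x ` {..<n} \<subseteq> A" using XA intx by (force simp: image_iff)
  moreover have "y ` {..<k} \<subseteq> A"
  proof (rule image_subsetI)
    fix i assume "i \<in> {..<k}"
    then have "int (y i) \<in> int ` A" using zA[of i] inty[of i] by (simp add: m_def)
    then show "y i \<in> A" by (simp add: inj_image_mem_iff)
  qed
  moreover have "(\<Sum>i<n. c i * int (x i)) + f (\<lambda>i. int (y i)) = 0"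
  proof -
    have "(\<Sum>i<n. c i * int (x i)) = (\<Sum>i<n. c i * X i)" by (intro sum.cong) (simp_all add: intx)
    also have "\<dots> = (\<Sum>j\<in>J. c j * X j) + (\<Sum>i\<in>{..<n} - J. c i * X i)"
      using J(1) by (simp add: sum.subset_diff)
    also have "(\<Sum>j\<in>J. c j * X j) = (\<Sum>j\<in>J. c j) * a + (\<Sum>j\<in>J. c j * t j z)"
      unfolding sum_distrib_right sum.distrib[symmetric]
      by (intro sum.cong) (auto simp: X_def algebra_simps)
    also have "(\<Sum>i\<in>{..<n} - J. c i * X i) = (\<Sum>i\<in>{..<n} - J. c i * (C * z (k + i)))"
      by (intro sum.cong) (auto simp: X_def)
    finally have "(\<Sum>i<n. c i * int (x i)) =
        (\<Sum>i\<in>{..<n} - J. c i * (C * z (k + i))) - Q (\<lambda>i. C * z i)"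
      by (simp add: cJ t_sum)
    moreover have "f (\<lambda>i. int (y i)) = f (\<lambda>i. C * z i)"
      by (rule mpoly_fun_cong[OF f]) (simp add: inty)
    ultimately show ?thesis by (simp add: Q_def)
  qed
  moreover have "inj_on x ({..<n} - {j0})"
  proof (rule inj_onI)
    fix i j assume ij: "i \<in> {..<n} - {j0}" "j \<in> {..<n} - {j0}" "x i = x j"
    then have "X i = X j" using intx[of i] intx[of j] by auto
    then show "i = j" using inj_onD[OF X_inj] ij by blast
  qed
  moreover have "inj_on y {..<k}"
  proof (rule inj_onI, rule ccontr)
    fix i j assume ij: "i \<in> {..<k}" "j \<in> {..<k}" "y i = y j" "i \<noteq> j"
    then have "C * z i = C * z j" using inty[of i] inty[of j] by auto
    then show False using zinj[of i j] ij C by (auto simp: m_def)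
  qed
  moreover have "inj_on x {..<n} \<and> x ` {..<n} \<inter> y ` {..<k} = {}" if "\<exists>v. f v \<noteq> 0"
  proof
    have X_j0: "X j0 \<noteq> X j" if "j < n" "j \<noteq> j0" for j
    proof (cases "j \<in> J")
      case True
      then have "(\<lambda>z. t j0 z - t j z) \<in> R"
        using \<open>\<exists>v. f v \<noteq> 0\<close> \<open>j \<noteq> j0\<close> unfolding R_def R2_def by blast
      from zR[OF this] show ?thesis using True j0 by (simp add: X_def)
    next
      case False
      then show ?thesis using X_out[of j j0] that J j0 by auto
    qed
    show "inj_on x {..<n}"
    proof (rule inj_onI, rule ccontr)
      fix i j assume ij: "i \<in> {..<n}" "j \<in> {..<n}" "x i = x j" "i \<noteq> j"
      then have "X i = X j" using intx[of i] intx[of j] by auto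
      then show False
        using ij X_j0[of i] X_j0[of j] inj_onD[OF X_inj, of i j] by (cases "i = j0"; cases "j = j0") auto
    qed
    have "x i \<noteq> y j" if "i < n" "j < k" for i j
    proof -
      have "X i \<noteq> C * z j"
        using big[of i j] zinj[of "k + i" j] that C by (auto simp: X_def m_def)
      then show ?thesis using intx[OF that(1)] inty[OF that(2)] by auto
    qed
    then show "x ` {..<n} \<inter> y ` {..<k} = {}" by auto
  qed
  moreover have "j0 < n" using J(1) j0 by auto
  ultimately show "\<exists>x y. rado_solution A n c k f x y" unfolding rado_solution_def by blast
qed

text \<open>Positive Banach density in integer arithmetic: in arbitrarily long intervals the
  proportion of \<open>A\<close> is at least \<open>1 / K\<close>, with one \<open>K\<close> for all
  lengths. This form is easy to transport along dilations.\<close>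

definition block_dense :: "nat set \<Rightarrow> bool" where
  "block_dense A \<longleftrightarrow>
     (\<exists>K>0. \<forall>N::nat. \<exists>a b. int N \<le> b - a \<and> b - a + 1 \<le> int (K * card (int ` A \<inter> {a..b})))"

lemma block_dense_imp_banach_density:
  assumes "block_dense A"
  shows "0 < banach_density (int ` A)"
proof -
  obtain K where K: "K > 0"
    "\<forall>N::nat. \<exists>a b. int N \<le> b - a \<and> b - a + 1 \<le> int (K * card (int ` A \<inter> {a..b}))"
    using assms by (auto simp: block_dense_def)
  obtain a b where ab: "\<And>N::nat. int N \<le> b N - a N"
    "\<And>N. b N - a N + 1 \<le> int (K * card (int ` A \<inter> {a N..b N}))"
    using K(2) by metis
  let ?r = "\<lambda>n. ereal (real (card (int ` A \<inter> {a n..b n})) / real_of_int (b n - a n + 1))"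
  have "1 / real K \<le> real (card (int ` A \<inter> {a n..b n})) / real_of_int (b n - a n + 1)" for n
  proof -
    have "0 < b n - a n + 1" using ab(1)[of n] by linarith
    then have "0 < real_of_int (b n - a n + 1)" by linarith
    moreover have "real_of_int (b n - a n + 1) \<le> real K * real (card (int ` A \<inter> {a n..b n}))"
      using ab(2)[of n] by (metis of_int_le_iff of_int_of_nat_eq of_nat_mult)
    ultimately show ?thesis using K(1) by (simp add: field_simps)
  qed
  then have "ereal (1 / real K) \<le> limsup ?r"
    by (intro le_Limsup) auto
  also have "limsup ?r \<le> banach_density (int ` A)"
    unfolding banach_density_def
  proof (intro Sup_upper CollectI exI conjI)
    show "filterlim (\<lambda>n. b n - a n) at_top sequentially"
      by (rule filterlim_at_top_mono[OF filterlim_int_sequentially]) (simp add: ab)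
  qed rule
  finally have "ereal (1 / real K) \<le> banach_density (int ` A)" .
  moreover have "0 < ereal (1 / real K)" using K(1) by simp
  ultimately show ?thesis by (rule less_le_trans[rotated])
qed

text \<open>Dilation stretches an interval by the factor \<open>N\<close> and keeps the number of
  points, so the constant becomes \<open>N * K\<close>.\<close>

lemma block_dense_dilate:
  assumes "block_dense {m. N * m \<in> A}" "N > 0"
  shows "block_dense A"
proof -
  obtain K where K: "K > 0" "\<And>M::nat. \<exists>a b. int M \<le> b - a \<and>
      b - a + 1 \<le> int (K * card (int ` {m. N * m \<in> A} \<inter> {a..b}))"
    using assms(1) unfolding block_dense_def by blast
  have "\<exists>a b. int M \<le> b - a \<and> b - a + 1 \<le> int (N * K * card (int ` A \<inter> {a..b}))" for M
  proof -
    obtain a b where ab: "int M \<le> b - a"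
      "b - a + 1 \<le> int (K * card (int ` {m. N * m \<in> A} \<inter> {a..b}))" (is "_ \<le> int (K * card ?B)")
      using K(2)[of M] by blast
    have "(\<lambda>x. int N * x) ` ?B \<subseteq> int ` A \<inter> {int N * a..int N * b}"
      using assms(2) by (auto simp: image_iff) (metis of_nat_mult)
    then have "card ?B \<le> card (int ` A \<inter> {int N * a..int N * b})"
      using assms(2) by (intro card_inj_on_le[of "\<lambda>x. int N * x"]) (auto simp: inj_on_def)
    then have le: "int (N * K * card ?B) \<le> int (N * K * card (int ` A \<inter> {int N * a..int N * b}))"
      unfolding of_nat_le_iff by (rule mult_le_mono2)
    have "1 * (b - a) \<le> int N * (b - a)" using ab(1) assms(2) by (intro mult_right_mono) auto
    moreover have "int N * (b - a + 1) \<le> int N * int (K * card ?B)"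
      using ab(2) by (intro mult_left_mono) auto
    ultimately show ?thesis
      using le ab(1) assms(2)
      by (intro exI[of _ "int N * a"] exI[of _ "int N * b"]) (simp add: algebra_simps)
  qed
  then show ?thesis
    unfolding block_dense_def using K(1) assms(2) by (intro exI[of _ "N * K"]) simp
qed

text \<open>Each of \<open>N + 1\<close> consecutive points is brought into \<open>A\<close> by a
  shift from \<open>H\<close>, so \<open>card H\<close> copies of a piece of \<open>A\<close> cover
  them; the interval is widened on both sides by the bound \<open>M\<close> for the shifts. The
  factor \<open>2 * M + 1\<close> absorbs the widening, as
  \<open>N + 2 * M + 1 \<le> (2 * M + 1) * (N + 1)\<close>.\<close>

lemma syndetic_imp_block_dense:
  fixes \<Phi> :: "int filter"
  assumes inv: "\<And>P t. eventually P \<Phi> \<Longrightarrow> \<forall>\<^sub>F a in \<Phi>. P (a + t)" and "\<Phi> \<noteq> bot"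
    and H: "finite H" "\<forall>\<^sub>F a in \<Phi>. \<exists>h\<in>H. a + h \<in> int ` A"
  shows "block_dense A"
proof -
  define M where "M = (\<Sum>h\<in>H. \<bar>h\<bar>)"
  have M: "\<bar>h\<bar> \<le> M" if "h \<in> H" for h
    unfolding M_def using H(1) that by (intro member_le_sum) auto
  have M0: "M \<ge> 0" by (simp add: M_def sum_nonneg)
  have "H \<noteq> {}" using H \<open>\<Phi> \<noteq> bot\<close> by auto
  have "\<exists>a b. int N \<le> b - a \<and>
      b - a + 1 \<le> int (nat (2 * M + 1) * card H * card (int ` A \<inter> {a..b}))" for N
  proof -
    have "\<forall>\<^sub>F a in \<Phi>. \<forall>i\<in>{..N}. \<exists>h\<in>H. a + int i + h \<in> int ` A"
      using inv[OF H(2)] by (intro eventually_ball_finite) auto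
    then obtain a where a: "\<forall>i\<in>{..N}. \<exists>h\<in>H. a + int i + h \<in> int ` A"
      using eventually_happens'[OF \<open>\<Phi> \<noteq> bot\<close>] by blast
    let ?I = "int ` A \<inter> {a - M..a + int N + M}"
    have "(\<lambda>i. a + int i) ` {..N} \<subseteq> (\<Union>h\<in>H. (\<lambda>x. x - h) ` ?I)"
    proof (rule image_subsetI)
      fix i assume i: "i \<in> {..N}"
      then obtain h where h: "h \<in> H" "a + int i + h \<in> int ` A" using a by blast
      then have "a + int i + h \<in> ?I" using M[OF h(1)] i by auto
      then show "a + int i \<in> (\<Union>h\<in>H. (\<lambda>x. x - h) ` ?I)"
        using h(1) by (intro UN_I[of h]) (auto intro!: image_eqI[of _ _ "a + int i + h"])
    qed
    then have "card ((\<lambda>i. a + int i) ` {..N}) \<le> card (\<Union>h\<in>H. (\<lambda>x. x - h) ` ?I)"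
      using H(1) by (intro card_mono) auto
    also have "\<dots> \<le> (\<Sum>h\<in>H. card ((\<lambda>x. x - h) ` ?I))" by (rule card_UN_le[OF H(1)])
    also have "\<dots> \<le> (\<Sum>h\<in>H. card ?I)" by (intro sum_mono card_image_le) auto
    finally have "Suc N \<le> card H * card ?I" by (simp add: card_image inj_on_def)
    then have "int (Suc N) \<le> int (card H * card ?I)" unfolding of_nat_le_iff .
    then have "(2 * M + 1) * int (Suc N) \<le> (2 * M + 1) * int (card H * card ?I)"
      using M0 by (intro mult_left_mono) auto
    moreover have "2 * M * 1 \<le> 2 * M * int (Suc N)" using M0 by (intro mult_left_mono) auto
    ultimately have "int N + 2 * M + 1 \<le> (2 * M + 1) * int (card H * card ?I)"
      by (simp add: algebra_simps)
    then show ?thesis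
      using M0 by (intro exI[of _ "a - M"] exI[of _ "a + int N + M"]) (simp add: mult.assoc)
  qed
  then show ?thesis
    unfolding block_dense_def using H(1) \<open>H \<noteq> {}\<close> M0
    by (intro exI[of _ "nat (2 * M + 1) * card H"]) (auto simp: card_gt_0_iff)
qed

text \<open>Meant for sets of exponents, where arithmetic progressions turn into geometric
  ones.\<close>

definition ap_rich :: "nat set \<Rightarrow> bool" where
  "ap_rich A \<longleftrightarrow> (\<forall>L. \<exists>a d. d > 0 \<and> (\<forall>i\<le>L. a + i * d \<in> A))"

definition good_idempotents :: "nat filter set" where
  "good_idempotents = {p \<in> betaN. p \<oplus>\<^sub>\<beta> p = p \<and> p \<le> at_top \<and>
     (\<forall>A. (\<forall>\<^sub>F n in p. n \<in> A) \<longrightarrow> block_dense A \<and> rado_solvable A)}"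

lemma ex_good_idempotent:
  obtains p where "p \<in> good_idempotents" "\<And>A. \<forall>\<^sub>F n in p. n \<in> A \<Longrightarrow> ap_rich A"
proof -
  have top_inv: "invariant_filter (range (+)) (at_top :: int filter)"
    unfolding invariant_filter_def
  proof (clarify, rule filter_leI)
    fix s :: int and P :: "int \<Rightarrow> bool" assume "eventually P at_top"
    then obtain b where "\<forall>a\<ge>b. P a" unfolding eventually_at_top_linorder by blast
    then show "eventually P (filtermap ((+) s) at_top)"
      by (auto simp: eventually_filtermap eventually_at_top_linorder intro!: exI[of _ "b - s"])
  qed
  obtain \<Phi> :: "int filter" where \<Phi>: "\<Phi> \<le> at_top" "\<Phi> \<noteq> bot" "invariant_filter (range (+)) \<Phi>"
    and min: "\<And>G. G \<le> \<Phi> \<Longrightarrow> G \<noteq> bot \<Longrightarrow> invariant_filter (range (+)) G \<Longrightarrow> G = \<Phi>"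
    using ex_minimal_invariant_filter[OF _ top_inv] trivial_limit_at_top_linorder by blast
  have inv: "\<forall>\<^sub>F a in \<Phi>. P (a + t)" if "eventually P \<Phi>" for P t
    using invariant_filterD[OF \<Phi>(3) rangeI that, of t] by (simp add: add.commute)
  have cover: "\<exists>H. finite H \<and> (\<forall>\<^sub>F a in \<Phi>. \<exists>h\<in>H. P (a + h))" if "frequently P \<Phi>" for P
    using minimal_invariant_filter_cover[OF \<Phi>(3) min that] by blast
  \<comment> \<open>\<open>F\<close> describes the ultrafilters on the natural numbers that lie in
    the minimal subsystem. It is nontrivial because \<open>\<Phi>\<close> lives near infinity, and
    translation invariance makes it closed under addition.\<close>
  define F where "F = filtercomap int \<Phi>"
  have "F \<noteq> bot"
    unfolding F_def
  proof (rule filtercomap_neq_bot)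
    fix P assume "eventually P \<Phi>"
    moreover have "eventually (\<lambda>a. a \<ge> 0) \<Phi>"
      using \<Phi>(1) eventually_ge_at_top filter_leD by blast
    ultimately have "eventually (\<lambda>a. P a \<and> a \<ge> 0) \<Phi>" by (rule eventually_conj)
    then obtain a where "P a" "a \<ge> 0" using eventually_happens'[OF \<Phi>(2)] by blast
    then show "\<exists>x. P (int x)" by (intro exI[of _ "nat a"]) simp
  qed
  moreover have "uf_op (+) F V \<le> F" if "V \<le> F" for V
    unfolding F_def filtermap_le_iff_le_filtercomap[symmetric]
  proof (rule filter_leI)
    fix P assume P: "eventually P \<Phi>"
    have "\<forall>\<^sub>F m in V. P (int m + t)" for t
      using that filter_leD[OF _ inv[OF P, of t], of "filtermap int V"]
      by (simp add: F_def filtermap_le_iff_le_filtercomap eventually_filtermap)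
    then show "eventually P (filtermap int (uf_op (+) (filtercomap int \<Phi>) V))"
      by (simp add: eventually_filtermap eventually_uf_op)
  qed
  ultimately obtain p where p: "ultrafilter p" "p \<le> F" "uf_op (+) p p = p"
    using ex_idempotent_le[of "(+)" F, OF add.assoc] by blast
  have idem: "p \<oplus>\<^sub>\<beta> p = p" using p by (simp add: uf_plus_def)
  have le: "filtermap int p \<le> \<Phi>"
    using p(2) by (simp add: F_def filtermap_le_iff_le_filtercomap)
  have gt: "\<forall>\<^sub>F n in p. n > M" for M
  proof -
    have "\<forall>\<^sub>F a in filtermap int p. a > int M"
      using filter_leD[OF order_trans[OF le \<Phi>(1)] eventually_gt_at_top] .
    then show ?thesis by (simp add: eventually_filtermap)
  qed
  have "p \<le> at_top"
  proof (intro filter_leI)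
    fix P :: "nat \<Rightarrow> bool" assume "eventually P at_top"
    then obtain b where "\<forall>n>b. P n" by (auto simp: eventually_at_top_dense)
    then show "eventually P p" using gt[of b] by (auto elim: eventually_mono)
  qed
  have freq: "\<exists>\<^sub>F a in \<Phi>. a \<in> int ` A" if "\<forall>\<^sub>F n in p. n \<in> A" for A
  proof (rule ccontr)
    assume "\<not> ?thesis"
    then have "\<forall>\<^sub>F a in filtermap int p. a \<notin> int ` A"
      using le by (auto simp: frequently_def dest: filter_leD)
    then show False
      using that ultrafilter_not_iff[OF p(1)] by (simp add: eventually_filtermap inj_image_mem_iff)
  qed
  have "block_dense A \<and> rado_solvable A" if A: "\<forall>\<^sub>F n in p. n \<in> A" for A
    using syndetic_imp_block_dense[OF inv \<Phi>(2)] cover[OF freq[OF A]]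
      idempotent_rado_solvable[OF inv cover p(1) idem \<Phi>(1) le A] by blast
  then have "p \<in> good_idempotents"
    using p(1) gt[of 0] idem \<open>p \<le> at_top\<close> by (simp add: good_idempotents_def betaN_def)
  moreover have "ap_rich A" if A: "\<forall>\<^sub>F n in p. n \<in> A" for A
    unfolding ap_rich_def
  proof
    \<comment> \<open>Recurrence for the linear polynomials with slopes up to \<open>L\<close> is a
      progression with base point \<open>a\<close> and difference \<open>d\<close>.\<close>
    fix L :: nat
    have "\<forall>\<^sub>F d in filtermap int p. \<exists>\<^sub>F a in \<Phi>. a \<in> int ` A \<and>
        (\<forall>f\<in>(\<lambda>i. [:0, int i:]) ` {..L}. a + poly f d \<in> int ` A)"
    proof (rule polynomial_recurrence[OF inv cover ultrafilter_filtermap[OF p(1)] _ _ _ freq[OF A]])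
      fix P assume "eventually P (filtermap int p)"
      then have "eventually (\<lambda>n. P (int n)) (p \<oplus>\<^sub>\<beta> p)" by (simp add: idem eventually_filtermap)
      then show "\<forall>\<^sub>F n in filtermap int p. \<forall>\<^sub>F m in filtermap int p. P (m + n)"
        by (simp add: uf_plus_def eventually_uf_op eventually_filtermap)
    qed auto
    then have "\<forall>\<^sub>F d in p. (\<exists>\<^sub>F a in \<Phi>. a \<in> int ` A \<and>
        (\<forall>i\<in>{..L}. a + int d * int i \<in> int ` A)) \<and> d > 0"
      using gt[of 0] by (simp add: eventually_filtermap eventually_conj_iff)
    then obtain d where d: "d > 0"
      "\<exists>\<^sub>F a in \<Phi>. a \<in> int ` A \<and> (\<forall>i\<in>{..L}. a + int d * int i \<in> int ` A)"
      using eventually_happens'[OF ultrafilter_neq_bot[OF p(1)]] by blast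
    then obtain a where a: "a \<in> int ` A" "\<forall>i\<in>{..L}. a + int d * int i \<in> int ` A"
      using frequently_ex by blast
    then obtain a' where a': "a = int a'" by blast
    have "a' + i * d \<in> A" if "i \<le> L" for i
    proof -
      have "int (a' + i * d) \<in> int ` A" using a(2) that unfolding a' by (simp add: mult.commute[of i])
      then show ?thesis by (simp only: inj_image_mem_iff[OF inj_of_nat])
    qed
    then show "\<exists>a d. 0 < d \<and> (\<forall>i\<le>L. a + i * d \<in> A)" using d(1) by blast
  qed
  ultimately show thesis by (rule that)
qed

text \<open>Dividing a Rado equation evaluated at \<open>N x\<close>, \<open>N y\<close> by \<open>N\<close> gives a Rado equation.\<close>

lemma rado_solvable_dilate:
  assumes A: "rado_solvable {m. N * m \<in> A}" and "N > 0"
  shows "rado_solvable A"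
  unfolding rado_solvable_def
proof (intro allI impI, elim conjE)
  fix n k J f and c :: "nat \<Rightarrow> int"
  assume J: "J \<subseteq> {..<n}" "J \<noteq> {}" "\<forall>j\<in>J. c j \<noteq> 0" "(\<Sum>j\<in>J. c j) = 0" and f: "mpoly_fun k f"
  define g where "g z = f (\<lambda>i. int N * z i) div int N" for z
  have N: "int N \<noteq> 0" using \<open>N > 0\<close> by simp
  have g: "mpoly_fun k g" unfolding g_def by (rule mpoly_fun_scale(2)[OF f N])
  have Ng: "int N * g z = f (\<lambda>i. int N * z i)" for z
    unfolding g_def using mpoly_fun_scale(1)[OF f N] by simp
  have nz: "\<exists>v. g v \<noteq> 0" if v: "f v \<noteq> 0" for v
  proof -
    obtain z where "f (\<lambda>i. int N * z i) \<noteq> 0"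
      using mpoly_fun_nonzero_at_multiples[OF f v N] by blast
    then show ?thesis using Ng[of z] by (intro exI[of _ z]) auto
  qed
  have "J \<subseteq> {..<n} \<and> J \<noteq> {} \<and> (\<forall>j\<in>J. c j \<noteq> 0) \<and> (\<Sum>j\<in>J. c j) = 0 \<and> mpoly_fun k g"
    using J g by simp
  then obtain x y where "rado_solution {m. N * m \<in> A} n c k g x y"
    using A unfolding rado_solvable_def by blast
  note xy = this[unfolded rado_solution_def]
  have "rado_solution A n c k f (\<lambda>i. N * x i) (\<lambda>i. N * y i)"
    unfolding rado_solution_def
  proof (intro conjI impI)
    show "(\<lambda>i. N * x i) ` {..<n} \<subseteq> A" "(\<lambda>i. N * y i) ` {..<k} \<subseteq> A"
      using xy by auto
    have "(\<Sum>i<n. c i * int (N * x i)) + f (\<lambda>i. int (N * y i)) =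
        int N * ((\<Sum>i<n. c i * int (x i)) + g (\<lambda>i. int (y i)))"
      by (simp add: distrib_left Ng sum_distrib_left mult_ac)
    then show "(\<Sum>i<n. c i * int (N * x i)) + f (\<lambda>i. int (N * y i)) = 0"
      using xy by simp
    have inj: "inj_on (\<lambda>i. N * u i) I" if "inj_on u I" for u :: "nat \<Rightarrow> nat" and I
      using that \<open>N > 0\<close> by (auto simp: inj_on_def)
    show "\<exists>j0<n. inj_on (\<lambda>i. N * x i) ({..<n} - {j0})" using xy inj by blast
    show "inj_on (\<lambda>i. N * y i) {..<k}" using xy inj by blast
    assume "\<exists>v. f v \<noteq> 0"
    then have *: "inj_on x {..<n}" "x ` {..<n} \<inter> y ` {..<k} = {}" using xy nz by blast+
    show "inj_on (\<lambda>i. N * x i) {..<n}" using * inj by blast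
    show "(\<lambda>i. N * x i) ` {..<n} \<inter> (\<lambda>i. N * y i) ` {..<k} = {}"
      using *(2) \<open>N > 0\<close> by (auto simp: disjoint_iff)
  qed
  then show "\<exists>x y. rado_solution A n c k f x y" by blast
qed

text \<open>By distributivity, multiplication by \<open>N\<close> is an endomorphism of the additive
  semigroup, so it preserves idempotents; the properties of \<open>A\<close> are inherited from the
  set of \<open>m\<close> with \<open>N * m \<in> A\<close>.\<close>

lemma good_idempotents_dilate:
  assumes p: "p \<in> good_idempotents" and N: "N > 0"
  shows "filtermap ((*) N) p \<in> good_idempotents"
proof -
  have p1: "ultrafilter p" "\<forall>\<^sub>F n in p. 0 < n" "p \<oplus>\<^sub>\<beta> p = p" "p \<le> at_top"
    "\<And>A. \<forall>\<^sub>F n in p. n \<in> A \<Longrightarrow> block_dense A \<and> rado_solvable A"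
    using p by (auto simp: good_idempotents_def betaN_def)
  have idem: "eventually P p \<longleftrightarrow> (\<forall>\<^sub>F n in p. \<forall>\<^sub>F m in p. P (m + n))" for P
    by (subst (1) p1(3)[symmetric]) (simp only: uf_plus_def eventually_uf_op)
  have "filtermap ((*) N) p \<oplus>\<^sub>\<beta> filtermap ((*) N) p = filtermap ((*) N) p"
    unfolding filter_eq_iff
  proof
    fix P
    show "eventually P (filtermap ((*) N) p \<oplus>\<^sub>\<beta> filtermap ((*) N) p) =
        eventually P (filtermap ((*) N) p)"
      unfolding uf_plus_def eventually_uf_op eventually_filtermap idem[of "\<lambda>x. P (N * x)"]
      by (simp add: distrib_left)
  qed
  moreover have "filtermap ((*) N) p \<le> at_top"
  proof (rule filter_leI)
    fix P :: "nat \<Rightarrow> bool" assume "eventually P at_top"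
    then obtain b where b: "\<And>n. n \<ge> b \<Longrightarrow> P n" by (auto simp: eventually_at_top_linorder)
    have "\<forall>\<^sub>F n in p. n \<ge> b" using p1(4) eventually_ge_at_top filter_leD by blast
    then have "\<forall>\<^sub>F n in p. P (N * n)"
    proof eventually_elim
      case (elim n)
      have "n \<le> N * n" using N by simp
      then show ?case by (rule b[OF order_trans[OF elim]])
    qed
    then show "eventually P (filtermap ((*) N) p)" by (simp add: eventually_filtermap)
  qed
  moreover have "block_dense A \<and> rado_solvable A" if "\<forall>\<^sub>F n in filtermap ((*) N) p. n \<in> A" for A
  proof -
    have "\<forall>\<^sub>F n in p. n \<in> {m. N * m \<in> A}" using that by (simp add: eventually_filtermap)
    from p1(5)[OF this] show ?thesis
      using block_dense_dilate[OF _ N] rado_solvable_dilate[OF _ N] by blast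
  qed
  moreover have "\<forall>\<^sub>F n in filtermap ((*) N) p. 0 < n"
    using p1(2) N by (simp add: eventually_filtermap)
  ultimately show ?thesis
    using ultrafilter_filtermap[OF p1(1), of "(*) N"] unfolding good_idempotents_def betaN_def by blast
qed

section \<open>The witnessing ultrafilter and the closure properties\<close>

lemma topspace_beta_topology: "topspace beta_topology = betaN"
  by (auto simp: beta_topology_def topology_generated_by_topspace intro!: exI[of _ UNIV])

text \<open>The generating sets are closed under binary intersection, hence form a base, and only
  basic neighbourhoods of \<open>U\<close> have to be tested.\<close>

lemma closure_of_beta_topology_iff:
  assumes "S \<subseteq> betaN"
  shows "U \<in> beta_topology closure_of S \<longleftrightarrow>
    U \<in> betaN \<and> (\<forall>A. (\<forall>\<^sub>F n in U. n \<in> A) \<longrightarrow> (\<exists>V\<in>S. \<forall>\<^sub>F n in V. n \<in> A))"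
proof -
  define B where "B A = {U \<in> betaN. \<forall>\<^sub>F n in U. n \<in> A}" for A :: "nat set"
  have "openin beta_topology (B A)" for A
    unfolding beta_topology_def B_def by (rule topology_generated_by_Basis) auto
  moreover have "\<exists>A. U \<in> B A \<and> B A \<subseteq> T" if "openin beta_topology T" "U \<in> T" for T U
  proof -
    have "generate_topology_on (range B) T"
      using that(1) by (simp add: beta_topology_def B_def[abs_def] openin_topology_generated_by_iff)
    then show ?thesis using \<open>U \<in> T\<close>
    proof (induction arbitrary: U)
      case (Int a b)
      then obtain A A' where "U \<in> B A" "B A \<subseteq> a" "U \<in> B A'" "B A' \<subseteq> b" by blast
      then have "U \<in> B (A \<inter> A')" "B (A \<inter> A') \<subseteq> a \<inter> b"
        by (auto simp: B_def eventually_conj_iff)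
      then show ?case by blast
    qed blast+
  qed
  ultimately have "(\<forall>T. U \<in> T \<and> openin beta_topology T \<longrightarrow> (\<exists>V\<in>S. V \<in> T)) \<longleftrightarrow>
      (\<forall>A. U \<in> B A \<longrightarrow> (\<exists>V\<in>S. V \<in> B A))"
    by (meson subsetD)
  then show ?thesis
    unfolding in_closure_of topspace_beta_topology
    using assms by (auto simp: B_def subset_iff)
qed

section \<open>Ideals and idempotents of the multiplicative semigroup\<close>

lemma betaN_I: "ultrafilter U \<Longrightarrow> \<forall>\<^sub>F n in U. 0 < n \<Longrightarrow> U \<in> betaN"
  by (simp add: betaN_def)

lemma betaN_times:
  assumes "U \<in> betaN" "V \<in> betaN"
  shows "U \<odot>\<^sub>\<beta> V \<in> betaN"
proof (rule betaN_I)
  show "ultrafilter (U \<odot>\<^sub>\<beta> V)"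
    using assms by (simp add: betaN_def uf_times_def ultrafilter_uf_op)
  have U: "\<forall>\<^sub>F n in U. 0 < n" and V: "\<forall>\<^sub>F n in V. 0 < n" using assms by (auto simp: betaN_def)
  from U show "\<forall>\<^sub>F n in U \<odot>\<^sub>\<beta> V. 0 < n"
    unfolding uf_times_def eventually_uf_op
    by eventually_elim (use V in \<open>simp\<close>)
qed

lemma K_times_subset: "two_sided_ideal I \<Longrightarrow> K_times \<subseteq> I"
  unfolding K_times_def by blast

lemma betaN_ideal: "U \<in> betaN \<Longrightarrow> two_sided_ideal betaN"
  unfolding two_sided_ideal_def using betaN_times by blast

text \<open>The assumption \<open>finitary\<close> expresses that configurations for
  \<open>Q\<close> are finite and may be dilated. In one order of the factors a common multiplier
  \<open>m\<close> moves finitely many elements of a good set into \<open>A\<close>; in the other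
  order one fixed \<open>n\<close> moves a whole good set into \<open>A\<close>.\<close>

lemma two_sided_ideal_witnessing:
  assumes finitary: "\<And>A B. Q B \<Longrightarrow>
      (\<And>F. finite F \<Longrightarrow> F \<subseteq> B \<Longrightarrow> \<exists>m>0. \<forall>n\<in>F. n * m \<in> A) \<Longrightarrow> Q A"
    and W0: "W0 \<in> betaN" "\<And>A. \<forall>\<^sub>F n in W0. n \<in> A \<Longrightarrow> Q A"
  shows "two_sided_ideal {W \<in> betaN. \<forall>A. (\<forall>\<^sub>F n in W. n \<in> A) \<longrightarrow> Q A}"
  unfolding two_sided_ideal_def
proof (intro conjI ballI)
  fix W V assume W: "W \<in> {W \<in> betaN. \<forall>A. (\<forall>\<^sub>F n in W. n \<in> A) \<longrightarrow> Q A}" and V: "V \<in> betaN"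
  have posV: "\<forall>\<^sub>F m in V. 0 < m" and botV: "V \<noteq> bot"
    using V by (auto simp: betaN_def ultrafilter_neq_bot)
  have "Q A" if "\<forall>\<^sub>F n in W \<odot>\<^sub>\<beta> V. n \<in> A" for A
  proof (rule finitary)
    show "Q {n. \<forall>\<^sub>F m in V. m * n \<in> A}"
      using that W by (simp add: uf_times_def eventually_uf_op)
    fix F assume F: "finite F" "F \<subseteq> {n. \<forall>\<^sub>F m in V. m * n \<in> A}"
    then have "\<forall>\<^sub>F m in V. \<forall>n\<in>F. m * n \<in> A" by (intro eventually_ball_finite) auto
    with posV have "\<forall>\<^sub>F m in V. 0 < m \<and> (\<forall>n\<in>F. m * n \<in> A)" by (rule eventually_conj)
    then show "\<exists>m>0. \<forall>n\<in>F. n * m \<in> A"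
      using eventually_happens'[OF botV] by (auto simp: mult.commute)
  qed
  then show "W \<odot>\<^sub>\<beta> V \<in> {W \<in> betaN. \<forall>A. (\<forall>\<^sub>F n in W. n \<in> A) \<longrightarrow> Q A}"
    using W V betaN_times by simp
  have "Q A" if "\<forall>\<^sub>F n in V \<odot>\<^sub>\<beta> W. n \<in> A" for A
  proof -
    have "\<forall>\<^sub>F n in V. 0 < n \<and> (\<forall>\<^sub>F m in W. m * n \<in> A)"
      using that posV by (simp add: uf_times_def eventually_uf_op eventually_conj_iff)
    then obtain n where n: "0 < n" "\<forall>\<^sub>F m in W. m * n \<in> A"
      using eventually_happens'[OF botV] by blast
    then have "Q {m. m * n \<in> A}" using W by simp
    then show ?thesis
      by (rule finitary) (use n in auto)
  qed
  then show "V \<odot>\<^sub>\<beta> W \<in> {W \<in> betaN. \<forall>A. (\<forall>\<^sub>F n in W. n \<in> A) \<longrightarrow> Q A}"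
    using W V betaN_times by simp
qed (use W0 in auto)

text \<open>Dilation-invariant closed sets are closed left ideals, since every ultrafilter is a
  limit of positive integers. A minimal one contains an idempotent, and minimality places it in
  every two-sided ideal.\<close>

lemma ex_multiplicative_idempotent:
  obtains U where "U \<in> M_times" "U \<le> at_top"
    "\<And>A. \<forall>\<^sub>F n in U. n \<in> A \<Longrightarrow> \<exists>p\<in>good_idempotents. \<forall>\<^sub>F n in p. n \<in> A"
proof -
  define T where "T = {(*) N | N :: nat. N > 0}"
  define F where "F = Sup good_idempotents"
  obtain p0 where p0: "p0 \<in> good_idempotents" using ex_good_idempotent by blast
  have F: "eventually P F \<longleftrightarrow> (\<forall>p\<in>good_idempotents. eventually P p)" for P
    by (simp add: F_def eventually_Sup)
  have "F \<noteq> bot"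
    using p0 F[of "\<lambda>_. False"]
    by (auto simp: trivial_limit_def good_idempotents_def betaN_def ultrafilter_def)
  moreover have "invariant_filter T F"
    unfolding invariant_filter_def
  proof (intro ballI filter_leI)
    fix t P assume "t \<in> T" and P: "eventually P F"
    then obtain N where N: "t = (*) N" "N > 0" by (auto simp: T_def)
    show "eventually P (filtermap t F)"
      unfolding eventually_filtermap F
    proof
      fix p assume "p \<in> good_idempotents"
      then have "filtermap ((*) N) p \<in> good_idempotents" using N by (simp add: good_idempotents_dilate)
      then show "\<forall>\<^sub>F x in p. P (t x)" using P N by (auto simp: F eventually_filtermap)
    qed
  qed
  ultimately obtain L where L: "L \<le> F" "L \<noteq> bot" "invariant_filter T L"
    and min: "\<And>G. G \<le> L \<Longrightarrow> G \<noteq> bot \<Longrightarrow> invariant_filter T G \<Longrightarrow> G = L"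
    using ex_minimal_invariant_filter by blast
  have L_inv: "\<forall>\<^sub>F m in L. P (m * n)" if "eventually P L" "n > 0" for P n
  proof -
    have "(*) n \<in> T" using that by (auto simp: T_def)
    from invariant_filterD[OF L(3) this that(1)] show ?thesis by (simp add: mult.commute)
  qed
  have F_pos: "\<forall>\<^sub>F n in F. 0 < n" by (simp add: F good_idempotents_def betaN_def)
  have "uf_op (*) L V \<le> L" if "V \<le> L" for V
  proof (rule filter_leI)
    fix P assume P: "eventually P L"
    have "\<forall>\<^sub>F n in L. 0 < n" using F_pos L(1) filter_leD by blast
    then have "\<forall>\<^sub>F n in L. \<forall>\<^sub>F m in V. P (m * n)"
      by eventually_elim (use L_inv[OF P] that filter_leD in blast)
    then show "eventually P (uf_op (*) L V)" by (simp add: eventually_uf_op)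
  qed
  then obtain U where U: "ultrafilter U" "U \<le> L" "uf_op (*) U U = U"
    using ex_idempotent_le[of "(*)" L, OF mult.assoc L(2)] by blast
  have "U \<le> F" using U L by simp
  have U_beta: "U \<in> betaN" using U(1) F_pos \<open>U \<le> F\<close> by (auto intro: betaN_I dest: filter_leD)
  have "U \<in> I" if I: "two_sided_ideal I" for I
  proof -
    obtain V where V: "V \<in> I" "V \<in> betaN" using I by (auto simp: two_sided_ideal_def)
    have VI: "V \<odot>\<^sub>\<beta> U \<in> I" using I V U_beta by (simp add: two_sided_ideal_def)
    have Vpos: "\<forall>\<^sub>F n in V. 0 < n" using V(2) by (simp add: betaN_def)
    have VU: "ultrafilter (V \<odot>\<^sub>\<beta> U)" "V \<odot>\<^sub>\<beta> U \<le> L"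
    proof -
      show "ultrafilter (V \<odot>\<^sub>\<beta> U)" using betaN_times[OF V(2) U_beta] by (simp add: betaN_def)
      show "V \<odot>\<^sub>\<beta> U \<le> L"
      proof (rule filter_leI)
        fix P assume P: "eventually P L"
        from Vpos have "\<forall>\<^sub>F n in V. \<forall>\<^sub>F m in U. P (m * n)"
          by eventually_elim (use L_inv[OF P] U(2) filter_leD in blast)
        then show "eventually P (V \<odot>\<^sub>\<beta> U)" by (simp add: uf_times_def eventually_uf_op)
      qed
    qed
    \<comment> \<open>\<open>G\<close> describes the closed left ideal generated by
      \<open>V \<odot>\<^sub>\<beta> U\<close>. Lying inside the minimal one, it equals it, so
      \<open>U\<close> is a left multiple of \<open>V \<odot>\<^sub>\<beta> U\<close> and belongs to
      \<open>I\<close>.\<close>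
    define G where "G = uf_op (*) (principal {0<..}) (V \<odot>\<^sub>\<beta> U)"
    have G: "eventually P G \<longleftrightarrow> (\<forall>n>0. \<forall>\<^sub>F m in V \<odot>\<^sub>\<beta> U. P (m * n))" for P
      by (simp add: G_def eventually_uf_op eventually_principal Ball_def)
    have "G = L"
    proof (rule min)
      show "G \<le> L"
        unfolding le_filter_def G using L_inv filter_leD[OF VU(2)] by blast
      show "G \<noteq> bot"
        using ultrafilter_neq_bot[OF VU(1)] by (auto simp: G_def uf_op_eq_bot_iff principal_eq_bot_iff)
      show "invariant_filter T G"
        unfolding invariant_filter_def
      proof (intro ballI filter_leI)
        fix t P assume "t \<in> T" and P: "eventually P G"
        then obtain N where N: "t = (*) N" "N > 0" by (auto simp: T_def)
        have "\<forall>\<^sub>F m in V \<odot>\<^sub>\<beta> U. P (N * (m * n))" if "n > 0" for n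
        proof -
          have "\<forall>\<^sub>F m in V \<odot>\<^sub>\<beta> U. P (m * (N * n))" using P N that by (simp add: G)
          then show ?thesis by (simp add: mult_ac)
        qed
        then show "eventually P (filtermap t G)" by (simp add: eventually_filtermap G N)
      qed
    qed
    then have "U \<le> G" using U(2) by simp
    then obtain W where W: "ultrafilter W" "W \<le> principal {0<..}" "uf_op (*) W (V \<odot>\<^sub>\<beta> U) = U"
      using ultrafilter_le_uf_op_lift[OF U(1) _ VU(1)] unfolding G_def by blast
    have "W \<in> betaN" using W by (auto intro!: betaN_I simp: le_principal)
    then have "W \<odot>\<^sub>\<beta> (V \<odot>\<^sub>\<beta> U) \<in> I" using I VI by (simp add: two_sided_ideal_def)
    then show ?thesis using W(3) by (simp add: uf_times_def)
  qed
  then have "U \<in> M_times" using U(3) by (auto simp: M_times_def K_times_def uf_times_def)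
  moreover have "U \<le> at_top"
  proof -
    have "F \<le> at_top" unfolding F_def by (rule Sup_least) (simp add: good_idempotents_def)
    then show ?thesis using \<open>U \<le> F\<close> by simp
  qed
  moreover have "\<exists>p\<in>good_idempotents. \<forall>\<^sub>F n in p. n \<in> A" if "\<forall>\<^sub>F n in U. n \<in> A" for A
  proof (rule ccontr)
    assume "\<not> ?thesis"
    then have "\<forall>\<^sub>F n in F. n \<notin> A"
      by (auto simp: F good_idempotents_def betaN_def intro: ultrafilterD_not)
    then show False using \<open>U \<le> F\<close> that U(1) ultrafilter_not_iff filter_leD by blast
  qed
  ultimately show thesis by (rule that)
qed

lemma M_times_subset: "M_times \<subseteq> betaN"
proof
  fix U assume "U \<in> M_times"
  obtain p where "p \<in> good_idempotents" using ex_good_idempotent by blast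
  then have "two_sided_ideal betaN" by (intro betaN_ideal[of p]) (simp add: good_idempotents_def)
  then show "U \<in> betaN" using K_times_subset \<open>U \<in> M_times\<close> by (auto simp: M_times_def)
qed

lemma I_plus_subset: "I_plus \<subseteq> betaN"
  by (auto simp: I_plus_def)

text \<open>Since each member of \<open>U\<close> is a member of some good idempotent, the closure
  of \<open>I_plus\<close>, the Banach density and the Rado equations are all settled set by
  set.\<close>

lemma ex_good_ultrafilter:
  obtains U where "U \<in> good_ultrafilters" "U \<in> M_times" "U \<le> at_top"
    "\<And>A. \<forall>\<^sub>F n in U. n \<in> A \<Longrightarrow> rado_solvable A"
proof -
  obtain U where U: "U \<in> M_times" "U \<le> at_top"
    "\<And>A. \<forall>\<^sub>F n in U. n \<in> A \<Longrightarrow> \<exists>p\<in>good_idempotents. \<forall>\<^sub>F n in p. n \<in> A"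
    using ex_multiplicative_idempotent by blast
  have UN: "U \<in> betaN" using U(1) M_times_subset by blast
  have "U \<in> beta_topology closure_of M_times"
    unfolding closure_of_beta_topology_iff[OF M_times_subset] using UN U(1) by blast
  moreover have "U \<in> beta_topology closure_of I_plus"
    unfolding closure_of_beta_topology_iff[OF I_plus_subset] using UN U(3)
    by (fastforce simp: good_idempotents_def I_plus_def)
  moreover have "U \<in> BD"
    unfolding BD_def using UN U(3) block_dense_imp_banach_density
    by (fastforce simp: good_idempotents_def)
  ultimately have "U \<in> good_ultrafilters" by (simp add: good_ultrafilters_def)
  moreover have "rado_solvable A" if "\<forall>\<^sub>F n in U. n \<in> A" for A
    using U(3)[OF that] by (auto simp: good_idempotents_def)
  ultimately show thesis using that U by blast
qed

lemma witnesses_singleD: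
  assumes "witnesses U n f {(I, s)}" "A \<subseteq> {0<..}" "\<forall>\<^sub>F m in U. m \<in> A"
  obtains xs where "length xs = n" "set xs \<subseteq> A" "f (map real xs) = 0"
    "s \<le> card ((\<lambda>i. xs ! i) ` I)"
proof -
  have "\<exists>xs :: nat list. length xs = n \<and> set xs \<subseteq> A \<and> f (map real xs) = 0 \<and>
      (\<forall>(I, s)\<in>{(I, s)}. s \<le> card ((\<lambda>i. xs ! i) ` I))"
    using assms unfolding witnesses_def by blast
  then show thesis using that by auto
qed

text \<open>The elements of \<open>A\<close> that \<open>g\<close> represents by sufficiently
  distinct arguments from \<open>A\<close> form a set \<open>B\<close> that belongs to
  \<open>U\<close>: otherwise a solution inside \<open>A - B\<close> would produce an element of
  \<open>B\<close>. A solution for \<open>f\<close> in \<open>B\<close> is then completed by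
  representing its first entry.\<close>

lemma witnesses_compose:
  assumes U: "ultrafilter U"
    and f: "witnesses U (k + 1) f {(Suc ` I, s)}"
    and g: "witnesses U (n + 1) (\<lambda>v. hd v - g (tl v)) {(Suc ` J, t)}"
    and I: "I \<subseteq> {..<k}" and J: "J \<subseteq> {..<n}"
  shows "witnesses U (n + k) (\<lambda>v. f (g (take n v) # drop n v))
    {(J, t - 1), ((\<lambda>i. n + i) ` I, s - 1)}"
  unfolding witnesses_def
proof (intro allI impI)
  fix A :: "nat set" assume A: "A \<subseteq> {0<..}" "\<forall>\<^sub>F m in U. m \<in> A"
  define B where "B = {z \<in> A. \<exists>xs. length xs = n \<and> set xs \<subseteq> A \<and> g (map real xs) = real z \<and>
      t \<le> card ((\<lambda>i. xs ! i) ` J)}"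
  have "\<forall>\<^sub>F m in U. m \<in> B"
  proof (rule ccontr)
    assume "\<not> ?thesis"
    then have "\<forall>\<^sub>F m in U. m \<notin> B" by (rule ultrafilterD_not[OF U])
    with A(2) have "\<forall>\<^sub>F m in U. m \<in> A - B" by eventually_elim simp
    moreover have "A - B \<subseteq> {0<..}" using A(1) by blast
    ultimately obtain zs where zs: "length zs = n + 1" "set zs \<subseteq> A - B"
        "hd (map real zs) - g (tl (map real zs)) = 0" "t \<le> card ((\<lambda>i. zs ! i) ` Suc ` J)"
      using witnesses_singleD[OF g] by blast
    then obtain z xs where zx: "zs = z # xs" by (cases zs) auto
    have "z \<in> B"
      using zs by (auto simp: B_def zx image_image intro!: exI[of _ xs])
    then show False using zs(2) by (simp add: zx)
  qed
  moreover have "B \<subseteq> {0<..}" using A(1) by (auto simp: B_def)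
  ultimately obtain ws where ws: "length ws = k + 1" "set ws \<subseteq> B" "f (map real ws) = 0"
      "s \<le> card ((\<lambda>i. ws ! i) ` Suc ` I)"
    using witnesses_singleD[OF f] by blast
  then obtain z ys where zy: "ws = z # ys" by (cases ws) auto
  obtain xs where xs: "length xs = n" "set xs \<subseteq> A" "g (map real xs) = real z"
      "t \<le> card ((\<lambda>i. xs ! i) ` J)"
    using ws(2) by (auto simp: zy B_def)
  have "(\<lambda>i. (xs @ ys) ! i) ` J = (\<lambda>i. xs ! i) ` J"
    using J xs(1) by (intro image_cong) (auto simp: nth_append)
  moreover have "(\<lambda>i. (xs @ ys) ! i) ` (\<lambda>i. n + i) ` I = (\<lambda>i. ws ! i) ` Suc ` I"
    unfolding image_image using xs(1) by (intro image_cong) (auto simp: zy nth_append)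
  moreover have "f (g (take n (map real (xs @ ys))) # drop n (map real (xs @ ys))) = 0"
    using ws(3) xs by (simp add: zy)
  moreover have "set (xs @ ys) \<subseteq> A" using xs(2) ws(2) by (auto simp: zy B_def)
  ultimately show "\<exists>zs. length zs = n + k \<and> set zs \<subseteq> A \<and>
      f (g (take n (map real zs)) # drop n (map real zs)) = 0 \<and>
      (\<forall>(I, s)\<in>{(J, t - 1), ((\<lambda>i. n + i) ` I, s - 1)}. s \<le> card ((\<lambda>i. zs ! i) ` I))"
    using xs ws by (intro exI[of _ "xs @ ys"]) (auto simp: zy)
qed

text \<open>If \<open>U\<close> witnesses \<open>f\<close>, then the ultrafilter of all \<open>A\<close> such that \<open>N! / x \<in> A\<close> for \<open>U\<close>-most \<open>x\<close>
  and arbitrarily large \<open>N\<close> witnesses the composition of \<open>f\<close> with the reciprocals. By homogeneity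
  the ultrafilters witnessing it form an ideal, which therefore contains \<open>K(\<odot>)\<close>.\<close>

lemma witnesses_reciprocal:
  assumes U: "U \<in> betaN" "U \<in> beta_topology closure_of M_times"
    and f: "homogeneous n f" "witnesses U n f {(I, s)}" and I: "I \<subseteq> {..<n}"
  shows "witnesses U n (\<lambda>v. f (map (\<lambda>x. 1 / x) v)) {(I, s)}"
proof -
  define Q where "Q A \<longleftrightarrow> (\<exists>xs. length xs = n \<and> set xs \<subseteq> A \<inter> {0<..} \<and>
      f (map (\<lambda>x. 1 / x) (map real xs)) = 0 \<and> s \<le> card ((\<lambda>i. xs ! i) ` I))" for A
  have scale: "f (map (\<lambda>x. r * x) xs) = 0" if "f xs = 0" "r > 0" "length xs = n" "\<forall>x\<in>set xs. 0 < x"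
    for r xs
    using f(1) that unfolding homogeneous_def by fastforce
  have card_map: "card ((\<lambda>i. map h xs ! i) ` I) = card ((\<lambda>i. xs ! i) ` I)"
    if "length xs = n" "inj_on h (set xs)" for h :: "nat \<Rightarrow> nat" and xs
  proof -
    have "(\<lambda>i. map h xs ! i) ` I = h ` (\<lambda>i. xs ! i) ` I"
      unfolding image_image using I that(1) by (intro image_cong) auto
    moreover have "(\<lambda>i. xs ! i) ` I \<subseteq> set xs" using I that(1) by auto
    ultimately show ?thesis using that(2) by (simp add: card_image inj_on_subset)
  qed
  obtain \<N> :: "nat filter" where \<N>: "ultrafilter \<N>" "\<N> \<le> at_top"
    using ex_ultrafilter_le[of "at_top :: nat filter"] trivial_limit_at_top_linorder by blast
  have \<N>_ge: "\<forall>\<^sub>F m in \<N>. x \<le> m" for x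
    using \<N>(2) eventually_ge_at_top filter_leD by blast
  define W where "W = uf_op (\<lambda>m x. fact m div x) U \<N>"
  have div: "x * (fact m div x) = fact m" if "0 < x" "x \<le> m" for x m :: nat
    using that by (simp add: dvd_fact)
  have "two_sided_ideal {W \<in> betaN. \<forall>A. (\<forall>\<^sub>F n in W. n \<in> A) \<longrightarrow> Q A}"
  proof (rule two_sided_ideal_witnessing)
    show "W \<in> betaN"
    proof (rule betaN_I)
      show "ultrafilter W"
        unfolding W_def using U(1) \<N>(1) by (simp add: betaN_def ultrafilter_uf_op)
      have "\<forall>\<^sub>F x in U. 0 < x" using U(1) by (simp add: betaN_def)
      then show "\<forall>\<^sub>F n in W. 0 < n"
        unfolding W_def eventually_uf_op
      proof eventually_elim
        case (elim x)
        from \<N>_ge[of x] show ?case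
          by eventually_elim (metis div elim fact_nonzero gr0I mult_0_right)
      qed
    qed
  next
    fix A assume A: "\<forall>\<^sub>F n in W. n \<in> A"
    define B where "B = {x. 0 < x \<and> (\<forall>\<^sub>F m in \<N>. fact m div x \<in> A)}"
    have "\<forall>\<^sub>F x in U. x \<in> B"
      using A U(1) by (simp add: W_def eventually_uf_op B_def betaN_def eventually_conj_iff)
    moreover have "B \<subseteq> {0<..}" by (auto simp: B_def)
    ultimately obtain xs where xs: "length xs = n" "set xs \<subseteq> B" "f (map real xs) = 0"
        "s \<le> card ((\<lambda>i. xs ! i) ` I)"
      using witnesses_singleD[OF f(2)] by blast
    have "\<forall>\<^sub>F m in \<N>. \<forall>x\<in>set xs. fact m div x \<in> A \<and> x \<le> m"
      using xs(2) \<N>_ge by (intro eventually_ball_finite) (auto simp: B_def eventually_conj_iff)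
    then obtain m where m: "\<And>x. x \<in> set xs \<Longrightarrow> fact m div x \<in> A \<and> x \<le> m"
      using eventually_happens'[OF ultrafilter_neq_bot[OF \<N>(1)]] by blast
    have x_pos: "0 < x" if "x \<in> set xs" for x using that xs(2) by (auto simp: B_def)
    have dm: "x * (fact m div x) = fact m" if "x \<in> set xs" for x
      using div m x_pos that by blast
    define h where "h x = fact m div x" for x :: nat
    have h_pos: "h x > 0" if "x \<in> set xs" for x
      using dm[OF that] unfolding h_def by (metis fact_nonzero gr0I mult_0_right)
    have "inj_on h (set xs)"
    proof (rule inj_onI)
      fix x y assume "x \<in> set xs" "y \<in> set xs" "h x = h y"
      then have "x * h y = y * h y" using dm[of x] dm[of y] by (simp add: h_def)
      then show "x = y" using h_pos[OF \<open>y \<in> set xs\<close>] by simp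
    qed
    \<comment> \<open>The reciprocals of the new numbers are the old numbers divided by
      \<open>fact m\<close>, a common factor that homogeneity removes.\<close>
    moreover have eq: "map (\<lambda>x. 1 / x) (map real (map h xs)) = map (\<lambda>x. (1 / fact m) * x) (map real xs)"
    proof -
      have "1 / real (h x) = 1 / fact m * real x" if "x \<in> set xs" for x
      proof -
        have "real x * real (h x) = fact m"
          using dm[OF that] unfolding h_def by (metis of_nat_fact of_nat_mult)
        then show ?thesis using h_pos[OF that] x_pos[OF that] by (simp add: field_simps)
      qed
      then show ?thesis by simp
    qed
    have "f (map (\<lambda>x. 1 / x) (map real (map h xs))) = 0"
      unfolding eq by (rule scale[OF xs(3)]) (use xs(1) x_pos in auto)
    moreover have "set (map h xs) \<subseteq> A \<inter> {0<..}" using m h_pos by (auto simp: h_def)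
    ultimately show "Q A"
      unfolding Q_def using xs card_map[of xs h] by (intro exI[of _ "map h xs"]) auto
  next
    fix A B assume "Q B" and B: "\<And>F. finite F \<Longrightarrow> F \<subseteq> B \<Longrightarrow> \<exists>m>0. \<forall>n\<in>F. n * m \<in> A"
    then obtain xs where xs: "length xs = n" "set xs \<subseteq> B \<inter> {0<..}"
        "f (map (\<lambda>x. 1 / x) (map real xs)) = 0" "s \<le> card ((\<lambda>i. xs ! i) ` I)"
      unfolding Q_def by blast
    obtain m where m: "m > 0" "\<forall>x\<in>set xs. x * m \<in> A" using B[of "set xs"] xs(2) by auto
    have eq: "map (\<lambda>x. 1 / x) (map real (map (\<lambda>x. x * m) xs)) =
        map (\<lambda>x. (1 / real m) * x) (map (\<lambda>x. 1 / x) (map real xs))"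
      by simp
    have "f (map (\<lambda>x. 1 / x) (map real (map (\<lambda>x. x * m) xs))) = 0"
      unfolding eq by (rule scale[OF xs(3)]) (use xs(1,2) m(1) in auto)
    moreover have "inj_on (\<lambda>x. x * m) (set xs)" using m(1) by (auto simp: inj_on_def)
    moreover have "set (map (\<lambda>x. x * m) xs) \<subseteq> A \<inter> {0<..}" using m xs(2) by auto
    ultimately show "Q A"
      unfolding Q_def using xs card_map[of xs "\<lambda>x. x * m"]
      by (intro exI[of _ "map (\<lambda>x. x * m) xs"]) auto
  qed
  from K_times_subset[OF this] have K: "Q A" if "V \<in> M_times" "\<forall>\<^sub>F n in V. n \<in> A" for V A
    using that by (auto simp: M_times_def)
  show ?thesis
    unfolding witnesses_def
  proof (intro allI impI)
    fix A assume "A \<subseteq> {0<..}" and A: "\<forall>\<^sub>F n in U. n \<in> A"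
    obtain V where "V \<in> M_times" "\<forall>\<^sub>F n in V. n \<in> A"
      using U(2) A unfolding closure_of_beta_topology_iff[OF M_times_subset] by blast
    from K[OF this] show "\<exists>xs. length xs = n \<and> set xs \<subseteq> A \<and> f (map (\<lambda>x. 1 / x) (map real xs)) = 0 \<and>
        (\<forall>(I, s)\<in>{(I, s)}. s \<le> card ((\<lambda>i. xs ! i) ` I))"
      unfolding Q_def by auto
  qed
qed

section \<open>Rado polynomials\<close>

definition int_mpoly_eval :: "int_mpoly \<Rightarrow> (nat \<Rightarrow> int) \<Rightarrow> int" where
  "int_mpoly_eval P y =
     (\<Sum>m\<in>Poly_Mapping.keys P. Poly_Mapping.lookup P m *
        (\<Prod>i\<in>Poly_Mapping.keys m. y i ^ Poly_Mapping.lookup m i))"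

lemma of_int_int_mpoly_eval:
  "of_int (int_mpoly_eval P y) = mpoly_eval (\<lambda>i. of_int (y i)) P"
  by (simp add: int_mpoly_eval_def mpoly_eval_def)

lemma mpoly_eval_cong:
  assumes "mpoly_vars P \<subseteq> {..<k}" "\<And>i. i < k \<Longrightarrow> y i = y' i"
  shows "mpoly_eval y P = mpoly_eval y' P"
proof -
  have "y i = y' i" if "m \<in> Poly_Mapping.keys P" "i \<in> Poly_Mapping.keys m" for m i
    using that assms by (auto simp: mpoly_vars_def)
  then show ?thesis unfolding mpoly_eval_def by (intro sum.cong prod.cong) auto
qed

text \<open>Without a constant term every monomial contains a variable and so vanishes at the
  origin; sections are obtained by substituting constants for all variables but one.\<close>

lemma mpoly_fun_int_mpoly_eval:
  assumes vars: "mpoly_vars P \<subseteq> {..<k}" and null: "Poly_Mapping.lookup P 0 = 0"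
  shows "mpoly_fun k (int_mpoly_eval P)"
  unfolding mpoly_fun_def
proof (intro conjI allI impI)
  have vanish: "(\<Prod>i\<in>Poly_Mapping.keys m. (0 :: int) ^ Poly_Mapping.lookup m i) = 0"
    if m: "m \<in> Poly_Mapping.keys P" for m
  proof -
    have "m \<noteq> 0" using m null by (auto simp: in_keys_iff)
    then obtain i where "i \<in> Poly_Mapping.keys m" by (metis keys_eq_empty ex_in_conv)
    then show ?thesis by (intro prod_zero bexI[of _ i]) (auto simp: in_keys_iff)
  qed
  show "int_mpoly_eval P (\<lambda>_. 0) = 0"
    unfolding int_mpoly_eval_def
  proof (rule sum.neutral, rule ballI)
    fix m assume "m \<in> Poly_Mapping.keys P"
    then show "Poly_Mapping.lookup P m * (\<Prod>i\<in>Poly_Mapping.keys m. 0 ^ Poly_Mapping.lookup m i) = 0"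
      by (simp only: vanish mult_zero_right)
  qed
next
  fix y y' :: "nat \<Rightarrow> int" assume "\<forall>i<k. y i = y' i"
  then have "(of_int (int_mpoly_eval P y) :: real) = of_int (int_mpoly_eval P y')"
    unfolding of_int_int_mpoly_eval using vars by (intro mpoly_eval_cong) auto
  then show "int_mpoly_eval P y = int_mpoly_eval P y'" by simp
next
  fix y :: "nat \<Rightarrow> int" and i
  show "\<exists>q. \<forall>z. int_mpoly_eval P (y(i := z)) = poly q z"
  proof (intro exI allI)
    fix z
    show "int_mpoly_eval P (y(i := z)) = poly (\<Sum>m\<in>Poly_Mapping.keys P.
        smult (Poly_Mapping.lookup P m) (\<Prod>j\<in>Poly_Mapping.keys m.
          (if j = i then [:0, 1:] else [:y j:]) ^ Poly_Mapping.lookup m j)) z"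
      unfolding int_mpoly_eval_def poly_sum poly_smult poly_prod poly_power
      by (intro sum.cong arg_cong2[where f = "(*)"] prod.cong) auto
  qed
qed

text \<open>In one variable a monomial is determined by its exponent, so no two terms cancel and a
  non-zero polynomial with finitely many roots results. Non-vanishing as a function is what gives
  injectivity of all the \<open>x\<close>.\<close>

lemma int_mpoly_eval_univariate_nonzero:
  assumes "P \<noteq> 0" "mpoly_vars P \<subseteq> {..<1}"
  shows "\<exists>v. int_mpoly_eval P v \<noteq> 0"
proof -
  define q where "q = (\<Sum>m\<in>Poly_Mapping.keys P. monom (Poly_Mapping.lookup P m) (Poly_Mapping.lookup m 0))"
  have keys: "Poly_Mapping.keys m \<subseteq> {0}" if "m \<in> Poly_Mapping.keys P" for m
    using that assms(2) by (auto simp: mpoly_vars_def)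
  have eval: "int_mpoly_eval P (\<lambda>_. z) = poly q z" for z
  proof -
    have "(\<Prod>i\<in>Poly_Mapping.keys m. z ^ Poly_Mapping.lookup m i) = z ^ Poly_Mapping.lookup m 0"
      if "m \<in> Poly_Mapping.keys P" for m
    proof (cases "0 \<in> Poly_Mapping.keys m")
      case True
      then have "Poly_Mapping.keys m = {0}" using keys[OF that] by blast
      then show ?thesis by simp
    next
      case False
      then have "Poly_Mapping.keys m = {}" using keys[OF that] by blast
      then show ?thesis using False by (simp add: in_keys_iff)
    qed
    then show ?thesis
      unfolding int_mpoly_eval_def q_def poly_sum by (intro sum.cong) (simp_all add: poly_monom)
  qed
  obtain m0 where m0: "m0 \<in> Poly_Mapping.keys P" using assms(1) by (metis keys_eq_empty ex_in_conv)
  have keys_0: "Poly_Mapping.lookup m i = 0" if "m \<in> Poly_Mapping.keys P" "i \<noteq> 0" for m i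
    using keys[OF that(1)] that(2) by (auto simp flip: not_in_keys_iff_lookup_eq_zero)
  have "m = m0" if "m \<in> Poly_Mapping.keys P" "Poly_Mapping.lookup m 0 = Poly_Mapping.lookup m0 0" for m
  proof (rule poly_mapping_eqI)
    fix i
    show "Poly_Mapping.lookup m i = Poly_Mapping.lookup m0 i"
      using that(2) keys_0[OF that(1)] keys_0[OF m0] by (cases "i = 0") auto
  qed
  then have "coeff q (Poly_Mapping.lookup m0 0) =
      (\<Sum>m\<in>Poly_Mapping.keys P. if m = m0 then Poly_Mapping.lookup P m else 0)"
    unfolding q_def coeff_sum by (intro sum.cong) auto
  also have "\<dots> = Poly_Mapping.lookup P m0" using m0 by (simp add: sum.delta)
  finally have "coeff q (Poly_Mapping.lookup m0 0) \<noteq> 0" using m0 by (simp add: in_keys_iff)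
  then have "q \<noteq> 0" by auto
  then have "finite {z. poly q z = 0}" by (rule poly_roots_finite)
  then obtain z where "poly q z \<noteq> 0"
    using infinite_UNIV_int by (metis (mono_tags, lifting) UNIV_eq_I mem_Collect_eq)
  then show ?thesis using eval by metis
qed

text \<open>The monomials are single variables here, and evaluation at a unit vector reads off one
  coefficient.\<close>

lemma int_mpoly_eval_linear_nonzero:
  assumes P: "P \<noteq> 0" "mpoly_linear P" "Poly_Mapping.lookup P 0 = 0"
  shows "\<exists>v. int_mpoly_eval P v \<noteq> 0"
proof -
  have single: "\<exists>i. m = Poly_Mapping.single i 1" if m: "m \<in> Poly_Mapping.keys P" for m
  proof -
    have "m \<noteq> 0" using m P(3) by (auto simp: in_keys_iff)
    then obtain i where i: "i \<in> Poly_Mapping.keys m" by (metis keys_eq_empty ex_in_conv)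
    have "(\<Sum>j\<in>Poly_Mapping.keys m. Poly_Mapping.lookup m j) =
        Poly_Mapping.lookup m i + (\<Sum>j\<in>Poly_Mapping.keys m - {i}. Poly_Mapping.lookup m j)"
      using i by (simp add: sum.remove)
    moreover have "(\<Sum>j\<in>Poly_Mapping.keys m. Poly_Mapping.lookup m j) \<le> 1"
      using P(2) m by (simp add: mpoly_linear_def)
    moreover have "Poly_Mapping.lookup m i > 0" using i by (simp add: in_keys_iff)
    ultimately have 1: "Poly_Mapping.lookup m i = 1"
      and 0: "(\<Sum>j\<in>Poly_Mapping.keys m - {i}. Poly_Mapping.lookup m j) = 0" by linarith+
    have "\<forall>j\<in>Poly_Mapping.keys m - {i}. Poly_Mapping.lookup m j = 0" using 0 by simp
    then have "Poly_Mapping.lookup m j = 0" if "j \<noteq> i" for j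
      using that by (cases "j \<in> Poly_Mapping.keys m") (blast, simp add: in_keys_iff)
    then have "m = Poly_Mapping.single i 1"
      using 1 by (intro poly_mapping_eqI) (auto simp: lookup_single when_def)
    then show ?thesis by blast
  qed
  obtain m0 where m0: "m0 \<in> Poly_Mapping.keys P" using P(1) by (metis keys_eq_empty ex_in_conv)
  obtain i where i: "m0 = Poly_Mapping.single i 1" using single[OF m0] by blast
  define v where "v j = (if j = i then 1 else 0 :: int)" for j
  have "(\<Prod>j\<in>Poly_Mapping.keys m. v j ^ Poly_Mapping.lookup m j) = (if m = m0 then 1 else 0)"
    if m: "m \<in> Poly_Mapping.keys P" for m
  proof -
    obtain j where j: "m = Poly_Mapping.single j 1" using single[OF m] by blast
    have "m = m0 \<longleftrightarrow> j = i" unfolding i j by (metis lookup_single_eq lookup_single_not_eq one_neq_zero)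
    then show ?thesis by (simp add: j v_def)
  qed
  then have "int_mpoly_eval P v =
      (\<Sum>m\<in>Poly_Mapping.keys P. if m = m0 then Poly_Mapping.lookup P m else 0)"
    unfolding int_mpoly_eval_def by (intro sum.cong) auto
  also have "\<dots> = Poly_Mapping.lookup P m0" using m0 by (simp add: sum.delta)
  finally show ?thesis using m0 by (intro exI[of _ v]) (simp add: in_keys_iff)
qed

lemma card_pred_le_image:
  assumes "inj_on x ({..<n} - {j0})" "j0 < (n :: nat)"
  shows "n - 1 \<le> card (x ` {..<n})"
proof -
  have "card (x ` ({..<n} - {j0})) = n - 1" using assms by (simp add: card_image)
  then show ?thesis using card_mono[of "x ` {..<n}" "x ` ({..<n} - {j0})"] by auto
qed

text \<open>The three conditions differ only in whether \<open>P\<close> is known to be non-zero as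
  a function, which the univariate and the linear case supply.\<close>

lemma rado_polynomial_witnesses:
  assumes rado: "\<And>A. \<forall>\<^sub>F m in U. m \<in> A \<Longrightarrow> rado_solvable A" and P: "rado_polynomial n c k P"
  shows "witnesses U (n + k) (rado_fun n c P) {({..<n}, n - 1), ({n..<n + k}, k)}" (is ?A)
    and "n = 2 \<Longrightarrow> k = 1 \<Longrightarrow> P \<noteq> 0 \<Longrightarrow> witnesses U (n + k) (rado_fun n c P) {({0, 1}, 2)}"
      (is "_ \<Longrightarrow> _ \<Longrightarrow> _ \<Longrightarrow> ?B")
    and "P \<noteq> 0 \<Longrightarrow> mpoly_linear P \<Longrightarrow>
      witnesses U (n + k) (rado_fun n c P) {({..<n + k}, n + k)}" (is "_ \<Longrightarrow> _ \<Longrightarrow> ?C")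
proof -
  have vars: "mpoly_vars P \<subseteq> {..<k}" and null: "Poly_Mapping.lookup P 0 = 0" and n2: "n \<ge> 2"
    using P by (auto simp: rado_polynomial_def)
  have sol: "\<exists>x y. x ` {..<n} \<subseteq> A \<and> y ` {..<k} \<subseteq> A \<and>
      rado_fun n c P (map real (map x [0..<n] @ map y [0..<k])) = 0 \<and>
      (\<exists>j0<n. inj_on x ({..<n} - {j0})) \<and> inj_on y {..<k} \<and>
      ((\<exists>v. int_mpoly_eval P v \<noteq> 0) \<longrightarrow> inj_on x {..<n} \<and> x ` {..<n} \<inter> y ` {..<k} = {})"
    if A: "\<forall>\<^sub>F m in U. m \<in> A" for A
  proof -
    obtain J where "J \<subseteq> {..<n} \<and> J \<noteq> {} \<and> (\<forall>j\<in>J. c j \<noteq> 0) \<and> (\<Sum>j\<in>J. c j) = 0"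
      using P unfolding rado_polynomial_def by blast
    then obtain x y where "rado_solution A n c k (int_mpoly_eval P) x y"
      using rado[OF A] mpoly_fun_int_mpoly_eval[OF vars null] unfolding rado_solvable_def by blast
    note xy = this[unfolded rado_solution_def]
    let ?v = "map real (map x [0..<n] @ map y [0..<k])"
    have "mpoly_eval (\<lambda>i. ?v ! (n + i)) P = mpoly_eval (\<lambda>i. of_int (int (y i))) P"
      by (rule mpoly_eval_cong[OF vars]) (simp add: nth_append)
    moreover have "(\<Sum>i<n. of_int (c i) * ?v ! i) = (\<Sum>i<n. of_int (c i) * real (x i))"
      by (intro sum.cong) (auto simp: nth_append)
    ultimately have "rado_fun n c P ?v =
        of_int ((\<Sum>i<n. c i * int (x i)) + int_mpoly_eval P (\<lambda>i. int (y i)))"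
      unfolding rado_fun_def by (simp add: of_int_int_mpoly_eval)
    then have "rado_fun n c P ?v = 0" using xy by simp
    then show ?thesis using xy by blast
  qed
  have im: "(\<lambda>i. (map x [0..<n] @ map y [0..<k]) ! i) ` {..<n} = x ` {..<n}"
    "(\<lambda>i. (map x [0..<n] @ map y [0..<k]) ! i) ` {n..<n + k} = y ` {..<k}" for x y :: "nat \<Rightarrow> nat"
  proof -
    show "(\<lambda>i. (map x [0..<n] @ map y [0..<k]) ! i) ` {..<n} = x ` {..<n}"
      by (intro image_cong) (auto simp: nth_append)
    have "{n..<n + k} = (\<lambda>i. i + n) ` {..<k}"
      using image_add_atLeastLessThan'[of n 0 k] by (simp add: atLeast0LessThan add.commute)
    then show "(\<lambda>i. (map x [0..<n] @ map y [0..<k]) ! i) ` {n..<n + k} = y ` {..<k}"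
      by (simp only: image_image) (intro image_cong, auto simp: nth_append)
  qed
  show ?A
    unfolding witnesses_def
  proof (intro allI impI)
    fix A :: "nat set" assume "\<forall>\<^sub>F m in U. m \<in> A"
    from sol[OF this] obtain x y j0 where xy: "x ` {..<n} \<subseteq> A" "y ` {..<k} \<subseteq> A"
      "rado_fun n c P (map real (map x [0..<n] @ map y [0..<k])) = 0"
      "j0 < n" "inj_on x ({..<n} - {j0})" "inj_on y {..<k}" by blast
    have "set (map x [0..<n] @ map y [0..<k]) \<subseteq> A" using xy(1,2) by auto
    moreover have "n - 1 \<le> card (x ` {..<n})" by (rule card_pred_le_image[OF xy(5,4)])
    moreover have "card (y ` {..<k}) = k" using xy(6) by (simp add: card_image)
    ultimately show "\<exists>xs. length xs = n + k \<and> set xs \<subseteq> A \<and> rado_fun n c P (map real xs) = 0 \<and>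
        (\<forall>(I, s)\<in>{({..<n}, n - 1), ({n..<n + k}, k)}. s \<le> card ((\<lambda>i. xs ! i) ` I))"
      using xy(3) im[of x y] by (intro exI[of _ "map x [0..<n] @ map y [0..<k]"]) simp
  qed
  have full: "\<exists>x y. set (map x [0..<n] @ map y [0..<k]) \<subseteq> A \<and>
      rado_fun n c P (map real (map x [0..<n] @ map y [0..<k])) = 0 \<and>
      inj_on x {..<n} \<and> inj_on y {..<k} \<and> x ` {..<n} \<inter> y ` {..<k} = {}"
    if A: "\<forall>\<^sub>F m in U. m \<in> A" and nz: "\<exists>v. int_mpoly_eval P v \<noteq> 0" for A
  proof -
    obtain x y where "x ` {..<n} \<subseteq> A" "y ` {..<k} \<subseteq> A"
      "rado_fun n c P (map real (map x [0..<n] @ map y [0..<k])) = 0"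
      "inj_on x {..<n}" "inj_on y {..<k}" "x ` {..<n} \<inter> y ` {..<k} = {}"
      using sol[OF A] nz by blast
    moreover from this have "set (map x [0..<n] @ map y [0..<k]) \<subseteq> A" by auto
    ultimately show ?thesis by blast
  qed
  show ?B if nk: "n = 2" "k = 1" and "P \<noteq> 0"
    unfolding witnesses_def
  proof (intro allI impI)
    fix A :: "nat set" assume A: "\<forall>\<^sub>F m in U. m \<in> A"
    have "\<exists>v. int_mpoly_eval P v \<noteq> 0"
      using int_mpoly_eval_univariate_nonzero[OF \<open>P \<noteq> 0\<close>] vars nk by simp
    from full[OF A this] obtain x y where xy: "set (map x [0..<n] @ map y [0..<k]) \<subseteq> A"
      "rado_fun n c P (map real (map x [0..<n] @ map y [0..<k])) = 0" "inj_on x {..<n}" by blast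
    have "{0, 1} = {..<n}" using nk by auto
    then have "card ((\<lambda>i. (map x [0..<n] @ map y [0..<k]) ! i) ` {0, 1}) = 2"
      using im(1)[of x y] xy(3) nk by (simp add: card_image)
    then show "\<exists>xs. length xs = n + k \<and> set xs \<subseteq> A \<and> rado_fun n c P (map real xs) = 0 \<and>
        (\<forall>(I, s)\<in>{({0, 1}, 2)}. s \<le> card ((\<lambda>i. xs ! i) ` I))"
      using xy(1,2) by (intro exI[of _ "map x [0..<n] @ map y [0..<k]"]) simp
  qed
  show ?C if "P \<noteq> 0" "mpoly_linear P"
    unfolding witnesses_def
  proof (intro allI impI)
    fix A :: "nat set" assume A: "\<forall>\<^sub>F m in U. m \<in> A"
    from full[OF A int_mpoly_eval_linear_nonzero[OF that null]] obtain x y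
      where xy: "set (map x [0..<n] @ map y [0..<k]) \<subseteq> A"
      "rado_fun n c P (map real (map x [0..<n] @ map y [0..<k])) = 0"
      "inj_on x {..<n}" "inj_on y {..<k}" "x ` {..<n} \<inter> y ` {..<k} = {}" by blast
    have "{..<n + k} = {..<n} \<union> {n..<n + k}" by auto
    then have "(\<lambda>i. (map x [0..<n] @ map y [0..<k]) ! i) ` {..<n + k} = x ` {..<n} \<union> y ` {..<k}"
      using im[of x y] by (simp add: image_Un)
    then have "card ((\<lambda>i. (map x [0..<n] @ map y [0..<k]) ! i) ` {..<n + k}) = n + k"
      using xy(3-5) by (simp add: card_Un_disjoint card_image)
    then show "\<exists>xs. length xs = n + k \<and> set xs \<subseteq> A \<and> rado_fun n c P (map real xs) = 0 \<and>
        (\<forall>(I, s)\<in>{({..<n + k}, n + k)}. s \<le> card ((\<lambda>i. xs ! i) ` I))"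
      using xy(1,2) by (intro exI[of _ "map x [0..<n] @ map y [0..<k]"]) simp
  qed
qed

section \<open>Multiplicative equations\<close>

lemma card_nth_image_distinct:
  assumes "distinct v" "length v = n"
  shows "card ((\<lambda>i. v ! i) ` {..<n}) = n"
proof -
  have "(\<lambda>i. v ! i) ` {..<n} = set v" using assms(2) by (auto simp: set_conv_nth)
  then show ?thesis using assms by (simp add: distinct_card)
qed

text \<open>The multiplicative form of the finite sums argument: partial products are kept in the
  star \<open>A'\<close> of \<open>A\<close>, where they can be extended, and each new factor is
  chosen larger than the previous ones.\<close>

lemma product_witnesses:
  assumes U: "ultrafilter U" "U \<odot>\<^sub>\<beta> U = U" "U \<le> at_top" and k: "k \<ge> 2"
  shows "witnesses U (k + 1) (\<lambda>v. v ! 0 - (\<Prod>i<k. v ! (i + 1))) {({..<k + 1}, k + 1)}"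
  unfolding witnesses_def
proof (intro allI impI)
  fix A :: "nat set" assume A: "\<forall>\<^sub>F m in U. m \<in> A"
  have idem: "\<forall>\<^sub>F n in U. \<forall>\<^sub>F m in U. P (m * n)" if "eventually P U" for P
  proof -
    have "eventually P (U \<odot>\<^sub>\<beta> U)" using that U(2) by simp
    then show ?thesis by (simp add: uf_times_def eventually_uf_op)
  qed
  define A' where "A' n \<longleftrightarrow> n \<in> A \<and> (\<forall>\<^sub>F m in U. m * n \<in> A)" for n
  have evA': "eventually A' U"
    unfolding A'_def using A idem[OF A] by (rule eventually_conj)
  have A'_step: "\<forall>\<^sub>F m in U. A' (m * n)" if "A' n" for n
  proof -
    from that have *: "\<forall>\<^sub>F m in U. m * n \<in> A" by (simp add: A'_def)
    have "\<forall>\<^sub>F m in U. \<forall>\<^sub>F m' in U. m' * m * n \<in> A" by (rule idem[OF *])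
    with * show ?thesis unfolding A'_def by eventually_elim (simp add: mult_ac)
  qed
  have gt: "\<forall>\<^sub>F n in U. n > M" for M using U(3) eventually_gt_at_top filter_leD by blast
  have "\<exists>y. (\<forall>i\<le>t. y i \<in> A \<and> y i \<ge> 2) \<and> inj_on y {..t} \<and> A' (\<Prod>i\<le>t. y i)" for t :: nat
  proof (induction t)
    case 0
    have "\<forall>\<^sub>F n in U. A' n \<and> n > 1" using evA' gt by (rule eventually_conj)
    then obtain n where "A' n" "n > 1" using eventually_happens'[OF ultrafilter_neq_bot[OF U(1)]] by blast
    then show ?case by (intro exI[of _ "\<lambda>_. n"]) (auto simp: A'_def)
  next
    case (Suc t)
    then obtain y where y: "\<forall>i\<le>t. y i \<in> A \<and> y i \<ge> 2" "inj_on y {..t}" "A' (\<Prod>i\<le>t. y i)" by blast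
    have "\<forall>\<^sub>F n in U. A' (n * (\<Prod>i\<le>t. y i)) \<and> n \<in> A \<and> n > Max (y ` {..t}) \<and> n > 1"
      using A'_step[OF y(3)] A gt by (intro eventually_conj)
    then obtain n where n: "A' (n * (\<Prod>i\<le>t. y i))" "n \<in> A" "n > Max (y ` {..t})" "n > 1"
      using eventually_happens'[OF ultrafilter_neq_bot[OF U(1)]] by blast
    have "y i < n" if "i \<le> t" for i
      using n(3) Max_ge[of "y ` {..t}" "y i"] that by auto
    then have new: "n \<notin> y ` {..t}" by blast
    have "(y(Suc t := n)) ` {..t} = y ` {..t}" by (intro image_cong) auto
    then have "inj_on (y(Suc t := n)) {..Suc t}"
      using inj_on_fun_updI[OF y(2) new, of "Suc t"] new by (simp add: atMost_Suc)
    moreover have "(\<Prod>i\<le>t. (y(Suc t := n)) i) = (\<Prod>i\<le>t. y i)" by (intro prod.cong) auto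
    then have "A' (\<Prod>i\<le>Suc t. (y(Suc t := n)) i)" using n(1) by (simp add: mult.commute)
    moreover have "\<forall>i\<le>Suc t. (y(Suc t := n)) i \<in> A \<and> (y(Suc t := n)) i \<ge> 2"
      using y(1) n by (auto simp: le_Suc_eq)
    ultimately show ?case by blast
  qed
  from this[of "k - 1"] obtain y where y: "\<forall>i\<le>k - 1. y i \<in> A \<and> y i \<ge> 2" "inj_on y {..k - 1}"
    "A' (\<Prod>i\<le>k - 1. y i)" by blast
  have lk: "{..k - 1} = {..<k}" using k by auto
  define x where "x = (\<Prod>i<k. y i)"
  have "x \<noteq> y i" if "i < k" for i
  proof -
    \<comment> \<open>A second factor exists because \<open>k \<ge> 2\<close>; being at least
      \<open>2\<close>, it makes \<open>x\<close> at least twice \<open>y i\<close>.\<close>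
    define j where "j = (if i = 0 then 1 else 0 :: nat)"
    have j: "j < k" "j \<noteq> i" using k by (auto simp: j_def)
    have "x = y i * (\<Prod>l\<in>{..<k} - {i}. y l)" using that by (simp add: x_def prod.remove)
    also have "(\<Prod>l\<in>{..<k} - {i}. y l) = y j * (\<Prod>l\<in>{..<k} - {i} - {j}. y l)"
      using j by (intro prod.remove) auto
    finally have x: "x = y i * (y j * (\<Prod>l\<in>{..<k} - {i} - {j}. y l))" .
    have pos: "y l \<ge> 2" if "l < k" for l using y(1) that lk by auto
    then have "(\<Prod>l\<in>{..<k} - {i} - {j}. y l) \<ge> 1" by (intro prod_ge_1) force
    then have "2 * 1 \<le> y j * (\<Prod>l\<in>{..<k} - {i} - {j}. y l)"
      using pos[OF j(1)] by (intro mult_mono) auto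
    then have "y i * 2 \<le> x" unfolding x by (intro mult_mono) auto
    then show ?thesis using pos[OF that] by linarith
  qed
  then have "distinct (x # map y [0..<k])"
    using y(2) lk by (auto simp: distinct_map lessThan_atLeast0[symmetric])
  then have "card ((\<lambda>i. (x # map y [0..<k]) ! i) ` {..<k + 1}) = k + 1"
    by (rule card_nth_image_distinct) simp
  moreover have "set (x # map y [0..<k]) \<subseteq> A"
  proof -
    have "x \<in> A" using y(3) unfolding lk by (simp add: x_def A'_def)
    moreover have "y i \<in> A" if "i < k" for i using y(1) that by simp
    ultimately show ?thesis by auto
  qed
  ultimately show "\<exists>xs. length xs = k + 1 \<and> set xs \<subseteq> A \<and>
      map real xs ! 0 - (\<Prod>i<k. map real xs ! (i + 1)) = 0 \<and>
      (\<forall>(I, s)\<in>{({..<k + 1}, k + 1)}. s \<le> card ((\<lambda>i. xs ! i) ` I))"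
    by (intro exI[of _ "x # map y [0..<k]"]) (simp add: x_def)
qed

definition gp_rich :: "nat set \<Rightarrow> bool" where
  "gp_rich A \<longleftrightarrow> (\<forall>L. \<exists>b r. b > 0 \<and> r \<ge> 2 \<and> (\<forall>i\<le>L. b * r ^ i \<in> A))"

text \<open>Long geometric progressions are finite configurations that survive dilation. They occur
  in all members of the image of a suitable additive idempotent under
  \<open>n \<mapsto> 2 ^ n\<close>, so the ultrafilters witnessing them form an ideal.\<close>

lemma K_times_gp_rich:
  assumes "U \<in> K_times" "\<forall>\<^sub>F n in U. n \<in> A"
  shows "gp_rich A"
proof -
  obtain p where p: "p \<in> good_idempotents" "\<And>A. \<forall>\<^sub>F n in p. n \<in> A \<Longrightarrow> ap_rich A"
    using ex_good_idempotent by blast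
  have "two_sided_ideal {W \<in> betaN. \<forall>A. (\<forall>\<^sub>F n in W. n \<in> A) \<longrightarrow> gp_rich A}"
  proof (rule two_sided_ideal_witnessing)
    have "ultrafilter (filtermap (\<lambda>n. 2 ^ n) p)"
      using p(1) by (auto simp: good_idempotents_def betaN_def intro: ultrafilter_filtermap)
    then show "filtermap (\<lambda>n. 2 ^ n) p \<in> betaN" by (rule betaN_I) (simp add: eventually_filtermap)
  next
    fix A :: "nat set" assume "\<forall>\<^sub>F n in filtermap (\<lambda>n. 2 ^ n) p. n \<in> A"
    then have "\<forall>\<^sub>F n in p. n \<in> {n. 2 ^ n \<in> A}" by (simp add: eventually_filtermap)
    then have ap: "ap_rich {n. 2 ^ n \<in> A}" by (rule p(2))
    show "gp_rich A"
      unfolding gp_rich_def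
    proof
      fix L
      obtain a d where d: "d > 0" "\<forall>i\<le>L. a + i * d \<in> {n. 2 ^ n \<in> A}"
        using ap unfolding ap_rich_def by blast
      have "2 ^ a * (2 ^ d) ^ i \<in> A" if "i \<le> L" for i
      proof -
        have "2 ^ (a + i * d) \<in> A" using d(2) that by simp
        then show ?thesis by (simp add: power_add power_mult mult.commute[of i])
      qed
      moreover have "(2 :: nat) \<le> 2 ^ d" using d(1) by (simp add: self_le_power)
      ultimately show "\<exists>b r. b > 0 \<and> r \<ge> 2 \<and> (\<forall>i\<le>L. b * r ^ i \<in> A)"
        by (intro exI[of _ "2 ^ a"] exI[of _ "2 ^ d"]) simp
    qed
  next
    fix A B assume B: "gp_rich B"
      and AB: "\<And>F. finite F \<Longrightarrow> F \<subseteq> B \<Longrightarrow> \<exists>m>0. \<forall>n\<in>F. n * m \<in> A"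
    show "gp_rich A"
      unfolding gp_rich_def
    proof
      fix L
      obtain b r where br: "b > 0" "r \<ge> 2" "\<forall>i\<le>L. b * r ^ i \<in> B" using B unfolding gp_rich_def by blast
      then have "\<exists>m>0. \<forall>n\<in>(\<lambda>i. b * r ^ i) ` {..L}. n * m \<in> A" by (intro AB) auto
      then obtain m where m: "m > 0" "\<forall>i\<in>{..L}. b * r ^ i * m \<in> A" by blast
      then have "\<forall>i\<le>L. b * m * r ^ i \<in> A" by (simp add: mult_ac)
      then show "\<exists>b r. b > 0 \<and> r \<ge> 2 \<and> (\<forall>i\<le>L. b * r ^ i \<in> A)"
        using br m by (intro exI[of _ "b * m"] exI[of _ r]) simp
    qed
  qed
  then show ?thesis using K_times_subset assms by blast
qed

lemma prod_power_int: "x \<noteq> 0 \<Longrightarrow> (\<Prod>i<k. x powi f i) = x powi (\<Sum>i<k. f i)"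
  for x :: "'a :: field" and k :: nat
  by (induction k) (simp_all add: power_int_add)

text \<open>The monomial equation becomes the affine equation \<open>e\<^sub>0 = \<Sum>a\<^sub>j e\<^sub>j\<close> for the exponents in a geometric
  progression; it is translation invariant, and \<open>e\<^sub>j = X\<^sup>j\<close> makes the exponents distinct for large \<open>X\<close>.\<close>

lemma monomial_witnesses:
  fixes a :: "nat \<Rightarrow> int"
  assumes U: "U \<in> K_times" and a: "(\<Sum>i<k. a i) = 1" "2 \<le> card {i. i < k \<and> a i \<noteq> 0}"
  shows "witnesses U (k + 1) (\<lambda>v. v ! 0 - (\<Prod>i<k. (v ! (i + 1)) powi a i)) {({..<k + 1}, k + 1)}"
  unfolding witnesses_def
proof (intro allI impI)
  fix A :: "nat set" assume A: "\<forall>\<^sub>F m in U. m \<in> A"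
  \<comment> \<open>The roots of \<open>q i\<close> are the bases \<open>X\<close> for which the
    dependent exponent \<open>E\<close> equals \<open>X ^ i\<close>. Two non-zero coefficients keep
    \<open>q i\<close> from vanishing, since \<open>monom 1 i\<close> can cancel at most one of
    them.\<close>
  define q where "q i = (\<Sum>j<k. monom (a j) j) - monom 1 i" for i :: nat
  have "q i \<noteq> 0" for i
  proof
    assume "q i = 0"
    have "a j = 0" if "j < k" "j \<noteq> i" for j
    proof -
      have "coeff (q i) j = (\<Sum>l<k. if l = j then a l else 0)"
        using that by (simp add: q_def coeff_sum coeff_monom)
      also have "\<dots> = a j" using that by (simp add: sum.delta)
      finally show ?thesis using \<open>q i = 0\<close> by simp
    qed
    then have "{i. i < k \<and> a i \<noteq> 0} \<subseteq> {i}" by auto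
    then have "card {i. i < k \<and> a i \<noteq> 0} \<le> 1" using card_mono[of "{i}"] by auto
    then show False using a(2) by simp
  qed
  then have "finite (\<Union>i<k. {z. poly (q i) z = 0})" by (intro finite_UN_I) (auto simp: poly_roots_finite)
  moreover have "infinite {2 :: int..}" by (rule infinite_Ici)
  ultimately have "\<not> {2..} \<subseteq> (\<Union>i<k. {z. poly (q i) z = 0})" using finite_subset by blast
  then obtain z where z: "z \<ge> 2" "\<And>i. i < k \<Longrightarrow> poly (q i) z \<noteq> 0" by blast
  define X where "X = nat z"
  have X: "X \<ge> 2" "z = int X" using z(1) by (auto simp: X_def)
  define E where "E = (\<Sum>j<k. a j * int (X ^ j))"
  have E: "E \<noteq> int (X ^ i)" if "i < k" for i
    using z(2)[OF that] by (simp add: q_def poly_sum poly_monom X(2) E_def)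
  \<comment> \<open>Shifting all exponents by the same \<open>s\<close> makes the dependent one
    non-negative; the relation survives because the \<open>a i\<close> have sum
    \<open>1\<close>.\<close>
  define s where "s = nat \<bar>E\<bar>"
  define e0 where "e0 = nat (E + int s)"
  define e where "e j = X ^ j + s" for j
  have e0: "int e0 = E + int s" by (simp add: e0_def s_def)
  have e_sum: "(\<Sum>j<k. a j * int (e j)) = int e0"
  proof -
    have "(\<Sum>j<k. a j * int (e j)) = E + (\<Sum>j<k. a j) * int s"
      by (simp add: e_def E_def distrib_left sum.distrib sum_distrib_right)
    then show ?thesis by (simp add: a e0)
  qed
  define L where "L = e0 + (\<Sum>j<k. e j)"
  have L: "e0 \<le> L" "\<And>j. j < k \<Longrightarrow> e j \<le> L"
  proof -
    fix j assume "j < k"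
    then have "e j \<le> (\<Sum>j<k. e j)" by (intro member_le_sum) auto
    then show "e j \<le> L" by (simp add: L_def)
  qed (simp add: L_def)
  obtain b r where br: "b > 0" "r \<ge> 2" "\<And>i. i \<le> L \<Longrightarrow> b * r ^ i \<in> A"
    using K_times_gp_rich[OF U A] unfolding gp_rich_def by blast
  define g where "g i = b * r ^ i" for i
  have g_inj: "g i = g j \<longleftrightarrow> i = j" for i j using br(1,2) by (simp add: g_def)
  define v where "v = g e0 # map (\<lambda>j. g (e j)) [0..<k]"
  have "\<forall>j<k. e0 \<noteq> e j"
  proof (intro allI impI notI)
    fix j assume "j < k" "e0 = e j"
    then have "E + int s = int (X ^ j) + int s" using e0 by (simp add: e_def)
    then show False using E[OF \<open>j < k\<close>] by simp
  qed
  moreover have "e i = e j \<longleftrightarrow> i = j" for i j using X(1) by (simp add: e_def)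
  ultimately have "distinct v" by (auto simp: v_def distinct_map inj_on_def g_inj)
  then have "card ((\<lambda>i. v ! i) ` {..<k + 1}) = k + 1"
    by (rule card_nth_image_distinct) (simp add: v_def)
  moreover have "set v \<subseteq> A" using br(3) L by (auto simp: v_def g_def)
  moreover have "map real v ! 0 - (\<Prod>i<k. (map real v ! (i + 1)) powi a i) = 0"
  proof -
    have "(\<Prod>i<k. (map real v ! (i + 1)) powi a i) =
        (\<Prod>i<k. real b powi a i * real r powi (a i * int (e i)))"
    proof (intro prod.cong refl)
      fix i assume "i \<in> {..<k}"
      then have "map real v ! (i + 1) = real b * real r ^ e i" by (simp add: v_def g_def)
      also have "\<dots> powi a i = real b powi a i * (real r powi int (e i)) powi a i"
        by (simp add: power_int_mult_distrib)
      also have "(real r powi int (e i)) powi a i = real r powi (int (e i) * a i)"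
        by (simp only: power_int_mult)
      finally show "(map real v ! (i + 1)) powi a i = real b powi a i * real r powi (a i * int (e i))"
        by (simp add: mult.commute)
    qed
    also have "\<dots> = real b powi (\<Sum>i<k. a i) * real r powi (\<Sum>i<k. a i * int (e i))"
      using br(1,2) by (simp add: prod.distrib prod_power_int)
    also have "\<dots> = real b * real r ^ e0" by (simp add: a e_sum)
    finally show ?thesis by (simp add: v_def g_def)
  qed
  ultimately show "\<exists>xs. length xs = k + 1 \<and> set xs \<subseteq> A \<and>
      map real xs ! 0 - (\<Prod>i<k. (map real xs ! (i + 1)) powi a i) = 0 \<and>
      (\<forall>(I, s)\<in>{({..<k + 1}, k + 1)}. s \<le> card ((\<lambda>i. xs ! i) ` I))"
    by (intro exI[of _ v]) (simp add: v_def)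
qed

theorem theorem2p8:
  shows
    "(\<exists>U\<in>good_ultrafilters.
        (\<forall>n c k P. rado_polynomial n c k P \<longrightarrow>
           witnesses U (n + k) (rado_fun n c P) {({..<n}, n - 1), ({n..<n + k}, k)} \<and>
           (n = 2 \<and> k = 1 \<and> P \<noteq> 0 \<longrightarrow>
              witnesses U (n + k) (rado_fun n c P) {({0, 1}, 2)}) \<and>
           (P \<noteq> 0 \<and> mpoly_linear P \<longrightarrow>
              witnesses U (n + k) (rado_fun n c P) {({..<n + k}, n + k)})) \<and>
        (\<forall>k\<ge>2.
           witnesses U (k + 1) (\<lambda>v. v ! 0 - (\<Prod>i<k. v ! (i + 1))) {({..<k + 1}, k + 1)}) \<and>
        (\<forall>k (a :: nat \<Rightarrow> int). (\<Sum>i<k. a i) = 1 \<and> 2 \<le> card {i. i < k \<and> a i \<noteq> 0} \<longrightarrow>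
           witnesses U (k + 1) (\<lambda>v. v ! 0 - (\<Prod>i<k. (v ! (i + 1)) powi a i))
             {({..<k + 1}, k + 1)}))
     \<and>
     (\<forall>U\<in>good_ultrafilters.
        (\<forall>k n f g I s J t. I \<subseteq> {..<k} \<and> J \<subseteq> {..<n} \<and>
           witnesses U (k + 1) f {(Suc ` I, s)} \<and>
           witnesses U (n + 1) (\<lambda>v. hd v - g (tl v)) {(Suc ` J, t)} \<longrightarrow>
           witnesses U (n + k) (\<lambda>v. f (g (take n v) # drop n v))
             {(J, t - 1), ((\<lambda>i. n + i) ` I, s - 1)}) \<and>
        (\<forall>n f I s. I \<subseteq> {..<n} \<and> homogeneous n f \<and> witnesses U n f {(I, s)} \<longrightarrow>
           witnesses U n (\<lambda>v. f (map (\<lambda>x. 1 / x) v)) {(I, s)}))"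
proof (rule conjI)
  obtain U where U: "U \<in> good_ultrafilters" "U \<in> M_times" "U \<le> at_top"
    and rado: "\<And>A. \<forall>\<^sub>F n in U. n \<in> A \<Longrightarrow> rado_solvable A"
    using ex_good_ultrafilter by blast
  have ultra: "ultrafilter U" using U(2) M_times_subset by (auto simp: betaN_def)
  have idem: "U \<odot>\<^sub>\<beta> U = U" and K: "U \<in> K_times" using U(2) by (auto simp: M_times_def)
  show "\<exists>U\<in>good_ultrafilters.
        (\<forall>n c k P. rado_polynomial n c k P \<longrightarrow>
           witnesses U (n + k) (rado_fun n c P) {({..<n}, n - 1), ({n..<n + k}, k)} \<and>
           (n = 2 \<and> k = 1 \<and> P \<noteq> 0 \<longrightarrow>
              witnesses U (n + k) (rado_fun n c P) {({0, 1}, 2)}) \<and>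
           (P \<noteq> 0 \<and> mpoly_linear P \<longrightarrow>
              witnesses U (n + k) (rado_fun n c P) {({..<n + k}, n + k)})) \<and>
        (\<forall>k\<ge>2.
           witnesses U (k + 1) (\<lambda>v. v ! 0 - (\<Prod>i<k. v ! (i + 1))) {({..<k + 1}, k + 1)}) \<and>
        (\<forall>k (a :: nat \<Rightarrow> int). (\<Sum>i<k. a i) = 1 \<and> 2 \<le> card {i. i < k \<and> a i \<noteq> 0} \<longrightarrow>
           witnesses U (k + 1) (\<lambda>v. v ! 0 - (\<Prod>i<k. (v ! (i + 1)) powi a i))
             {({..<k + 1}, k + 1)})"
    by (intro bexI[OF _ U(1)] conjI allI impI; (elim conjE)?;
        rule rado_polynomial_witnesses[OF rado] product_witnesses[OF ultra idem U(3)]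
          monomial_witnesses[OF K]; assumption)
next
  show "\<forall>U\<in>good_ultrafilters.
        (\<forall>k n f g I s J t. I \<subseteq> {..<k} \<and> J \<subseteq> {..<n} \<and>
           witnesses U (k + 1) f {(Suc ` I, s)} \<and>
           witnesses U (n + 1) (\<lambda>v. hd v - g (tl v)) {(Suc ` J, t)} \<longrightarrow>
           witnesses U (n + k) (\<lambda>v. f (g (take n v) # drop n v))
             {(J, t - 1), ((\<lambda>i. n + i) ` I, s - 1)}) \<and>
        (\<forall>n f I s. I \<subseteq> {..<n} \<and> homogeneous n f \<and> witnesses U n f {(I, s)} \<longrightarrow>
           witnesses U n (\<lambda>v. f (map (\<lambda>x. 1 / x) v)) {(I, s)})"
  proof (intro ballI conjI allI impI; elim conjE)
    fix U assume "U \<in> good_ultrafilters"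
    then have U: "U \<in> betaN" "U \<in> beta_topology closure_of M_times"
      by (auto simp: good_ultrafilters_def BD_def)
    then have ultra: "ultrafilter U" by (simp add: betaN_def)
    show "witnesses U (n + k) (\<lambda>v. f (g (take n v) # drop n v))
        {(J, t - 1), ((\<lambda>i. n + i) ` I, s - 1)}"
      if "I \<subseteq> {..<k}" "J \<subseteq> {..<n}" "witnesses U (k + 1) f {(Suc ` I, s)}"
        "witnesses U (n + 1) (\<lambda>v. hd v - g (tl v)) {(Suc ` J, t)}" for k n f g I s J t
      by (rule witnesses_compose[OF ultra that(3,4,1,2)])
    show "witnesses U n (\<lambda>v. f (map (\<lambda>x. 1 / x) v)) {(I, s)}"
      if "I \<subseteq> {..<n}" "homogeneous n f" "witnesses U n f {(I, s)}" for n f I s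
      by (rule witnesses_reciprocal[OF U that(2,3,1)])
  qed
qed

end
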